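(* Let $\bar\gamma$ be a proper-biharmonic Frenet curve in $\mathbb{C}P^2$ of osculating order $4$. Then $\bar\gamma$ is a holomorphic helix of order $4$ of class $I_3$ or $I_4$, according to the following: it is of class $I_3$ if $\bar\tau_{12}<0$ and $\bar\tau_{23}<0$, and of class $I_4$ if $\bar\tau_{12}>0$ and $\bar\tau_{23}>0$. Conversely: (a) For any $\alpha_0\in\left(\frac{\pi}{2},\arccos\left(-\frac{2-\sqrt3}{\sqrt2}\right)\right)$ there exist two proper-biharmonic holomorphic helices of order $4$ in $\mathbb{C}P^2$ of class $I_3$ with $$ \begin{cases} \bar k_2=\frac{\sin\alpha_0}{\sqrt2}\sqrt{1-3\cos^2\alpha_0\pm\sqrt{9\cos^4\alpha_0-42\cos^2\alpha_0+1}}\\ \bar k_3=-\frac{3}{2\bar k_2}\sin(2\alpha_0)\\ \bar k_1=-\frac{1}{\sin\alpha_0}(\bar k_2\cos\alpha_0-\bar k_3\sin\alpha_0). \end{cases} $$ (b) For any $\alpha_0\in\left(\frac{3\pi}{2},\pi+\arccos\left(-\frac{2-\sqrt3}{\sqrt2}\right)\right)$ there exist two proper-biharmonic holomorphic helices of order $4$ in $\mathbb{C}P^2$ of class $I_4$ with $$ \begin{cases} \bar k_2=-\frac{\sin\alpha_0}{\sqrt2}\sqrt{1-3\cos^2\alpha_0\pm\sqrt{9\cos^4\alpha_0-42\cos^2\alpha_0+1}}\\ \bar k_3=-\frac{3}{2\bar k_2}\sin(2\alpha_0)\\ \bar k_1=-\frac{1}{\sin\alpha_0}(\bar k_2\cos\alpha_0-\bar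 k_3\sin\alpha_0). \end{cases} $$
   Context: $\mathbb{C}P^n$ carries the Fubini-Study metric $\langle\cdot,\cdot\rangle$ of constant holomorphic sectional curvature $4$, with complex structure $\bar J$ and Levi-Civita connection $\bar\nabla$. A curve $\bar\gamma:I\subset\mathbb{R}\to\mathbb{C}P^n$ parametrized by arc-length is a Frenet curve of osculating order $d$ ($1\le d\le 2n$) if there exist $d$ orthonormal vector fields $\bar E_1=\bar\gamma',\dots,\bar E_d$ along $\bar\gamma$ such that $\bar\nabla_{\bar E_1}\bar E_1=\bar k_1\bar E_2$, $\bar\nabla_{\bar E_1}\bar E_i=-\bar k_{i-1}\bar E_{i-1}+\bar k_i\bar E_{i+1}$ for $2\le i\le d-1$, $\bar\nabla_{\bar E_1}\bar E_d=-\bar k_{d-1}\bar E_{d-1}$, where $\bar k_1,\dots,\bar k_{d-1}$ are positive functions (the curvatures). It is a helix of order $d$ if all $\bar k_i$ are positive constants. The complex torsions are $\bar\tau_{ij}=\langle\bar E_i,\bar J\bar E_j\rangle$, $1\le i<j\le d$; a helix of order $d$ is a holomorphic helix of order $d$ if all its complex torsions are constant. A holomorphic helix of order $4$ in $\mathbb{C}P^2$ with $\bar k_1\ne\bar k_3$, setting $\nu=\dfrac{\bar k_1-\bar k_3}{\sqrt{\bar k_2^2+(\bar k_1-\bar k_3)^2}}$, is of class $I_3$ if $\bar\tau_{12}=-\bar\tau_{34}=\nu$, $\bar\tau_{23}=-\bar\tau_{14}=\bar k_2\nu/(\bar k_1-\bar k_3)$, $\bar\tau_{13}=\bar\tau_{24}=0$;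 and of class $I_4$ if $\bar\tau_{12}=-\bar\tau_{34}=-\nu$, $\bar\tau_{23}=-\bar\tau_{14}=-\bar k_2\nu/(\bar k_1-\bar k_3)$, $\bar\tau_{13}=\bar\tau_{24}=0$. A map $\varphi:(M,g)\to(N,h)$ is biharmonic if $\tau_2(\varphi)=-\Delta^{\varphi}\tau(\varphi)-\operatorname{trace}R^N(d\varphi,\tau(\varphi))d\varphi=0$, where $\tau(\varphi)=\operatorname{trace}\nabla d\varphi$, $\Delta^\varphi=-\operatorname{trace}(\nabla^\varphi)^2$ and $R^N(X,Y)Z=\nabla_X\nabla_YZ-\nabla_Y\nabla_XZ-\nabla_{[X,Y]}Z$; it is proper-biharmonic if moreover it is not harmonic. A curve is proper-biharmonic if it is so as a map from the interval $I$.
   Formalization: The sign conditions are interchanged (class I_3 if τ12>0 and τ23>0, class I_4 if τ12<0 and τ23<0), and in (a), (b) it is also assumed that 9cos^4 α0 − 42cos^2 α0 + 1 > 0, since the printed intervals contain α0 for which k2 is not real. *)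

theory Defs
  imports "HOL-Analysis.Analysis"
begin

section \<open>Complex projective space with its Fubini-Study structure\<close>

text \<open>
  A complex line spanned by a unit vector v is identified with the orthogonal projector
  \<open>v v\<^sup>*\<close> onto it. This realises complex projective space as a compact submanifold of the
  Euclidean space of Hermitian matrices: its smooth structure, its metric and its Levi-Civita
  connection are those induced from the ambient space. The scaling of the metric is the one for
  which the Hopf fibration of the unit sphere is a Riemannian submersion, that is, the one of
  constant holomorphic sectional curvature 4. For the index type \<open>3\<close> one gets the complex
  projective plane.
\<close>

definition ctransp :: "complex^'n^'m \<Rightarrow> complex^'m^'n" where
  "ctransp A = (\<chi> i j. cnj (A $ j $ i))"

definition outer :: "complex^'n \<Rightarrow> complex^'n \<Rightarrow> complex^'n^'n" where
  "outer u v = (\<chi> i j. u $ i * cnj (v $ j))"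

definition hopf :: "complex^'n \<Rightarrow> complex^'n^'n" where
  "hopf v = outer v v"

definition cproj :: "(complex^'n^'n) set" where
  "cproj = hopf ` sphere 0 1"

text \<open>The linearisation of \<open>P\<^sup>* = P\<close> and \<open>P ** P = P\<close>.\<close>

definition tangent_cproj :: "complex^'n^'n \<Rightarrow> (complex^'n^'n) set" where
  "tangent_cproj P = {X. ctransp X = X \<and> P ** X + X ** P = X}"

text \<open>On Hermitian matrices the inner product \<open>X \<bullet> Y\<close> is the trace of \<open>X ** Y\<close>.\<close>

definition fs_metric :: "complex^'n^'n \<Rightarrow> complex^'n^'n \<Rightarrow> real" where
  "fs_metric X Y = (X \<bullet> Y) / 2"

text \<open>
  The matrix commutator times the imaginary unit; it sends \<open>u v\<^sup>* + v u\<^sup>*\<close> to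
  \<open>(\<i>u) v\<^sup>* + v (\<i>u)\<^sup>*\<close> (see \<open>cplx_str_hopf\<close>).
\<close>

definition cplx_str :: "complex^'n^'n \<Rightarrow> complex^'n^'n \<Rightarrow> complex^'n^'n" where
  "cplx_str P X = mat \<i> ** (X ** P - P ** X)"

text \<open>
  At a point P of the projective space this is the orthogonal projection of Hermitian matrices
  onto the tangent space (see \<open>tproj_orthogonal\<close>). The formula makes sense for all matrices P, so
  it also extends vector fields to the ambient space.
\<close>

definition tproj :: "complex^'n^'n \<Rightarrow> complex^'n^'n \<Rightarrow> complex^'n^'n" where
  "tproj P A = P ** A ** (mat 1 - P) + (mat 1 - P) ** A ** P"

text \<open>
  The Levi-Civita connection of a submanifold of Euclidean space is the tangential part of the
  ambient derivative.
\<close>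

definition cov_deriv ::
  "(complex^'n^'n \<Rightarrow> complex^'n^'n) \<Rightarrow> (complex^'n^'n \<Rightarrow> complex^'n^'n) \<Rightarrow> complex^'n^'n \<Rightarrow> complex^'n^'n" where
  "cov_deriv X Y P = tproj P (frechet_derivative Y (at P) (X P))"

definition lie_bracket ::
  "(complex^'n^'n \<Rightarrow> complex^'n^'n) \<Rightarrow> (complex^'n^'n \<Rightarrow> complex^'n^'n) \<Rightarrow> complex^'n^'n \<Rightarrow> complex^'n^'n" where
  "lie_bracket X Y P =
     frechet_derivative Y (at P) (X P) - frechet_derivative X (at P) (Y P)"

definition curv_field ::
  "(complex^'n^'n \<Rightarrow> complex^'n^'n) \<Rightarrow> (complex^'n^'n \<Rightarrow> complex^'n^'n) \<Rightarrow> (complex^'n^'n \<Rightarrow> complex^'n^'n)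
    \<Rightarrow> complex^'n^'n \<Rightarrow> complex^'n^'n" where
  "curv_field X Y Z P =
     cov_deriv X (cov_deriv Y Z) P - cov_deriv Y (cov_deriv X Z) P
       - cov_deriv (lie_bracket X Y) Z P"

text \<open>
  The curvature is a tensor, so it may be evaluated on any smooth tangent fields extending the
  given tangent vectors; \<open>\<lambda>Q. tproj Q X\<close> is one with value \<open>X\<close> at \<open>P\<close> (see \<open>tproj_tangent\<close>).
\<close>

definition curv :: "complex^'n^'n \<Rightarrow> complex^'n^'n \<Rightarrow> complex^'n^'n \<Rightarrow> complex^'n^'n \<Rightarrow> complex^'n^'n" where
  "curv P X Y Z = curv_field (\<lambda>Q. tproj Q X) (\<lambda>Q. tproj Q Y) (\<lambda>Q. tproj Q Z) P"


section \<open>Compatibility with the Hopf fibration\<close>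

lemma ctransp_outer: "ctransp (outer u v) = outer v u"
  by (simp add: ctransp_def outer_def vec_eq_iff mult.commute)

lemma ctransp_add: "ctransp (A + B) = ctransp A + ctransp B"
  by (simp add: ctransp_def vec_eq_iff)

lemma ctransp_diff: "ctransp (A - B) = ctransp A - ctransp B"
  by (simp add: ctransp_def vec_eq_iff)

lemma ctransp_mult: "ctransp (A ** B) = ctransp B ** ctransp A"
  by (simp add: ctransp_def matrix_matrix_mult_def vec_eq_iff mult.commute)

lemma ctransp_ctransp [simp]: "ctransp (ctransp A) = A"
  by (simp add: ctransp_def vec_eq_iff)

lemma matrix_add_rdistrib': "((A::complex^'n^'n) + B) ** C = A ** C + B ** C"
  by (simp add: matrix_matrix_mult_def vec_eq_iff sum.distrib distrib_right)

lemma matrix_diff_ldistrib: "(A::complex^'n^'n) ** (B - C) = A ** B - A ** C"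
  by (simp add: matrix_matrix_mult_def vec_eq_iff sum_subtractf right_diff_distrib)

lemma matrix_diff_rdistrib: "((A::complex^'n^'n) - B) ** C = A ** C - B ** C"
  by (simp add: matrix_matrix_mult_def vec_eq_iff sum_subtractf left_diff_distrib)

lemmas matrix_distribs =
  matrix_add_ldistrib matrix_add_rdistrib' matrix_diff_ldistrib matrix_diff_rdistrib

definition herm :: "complex^'n \<Rightarrow> complex^'n \<Rightarrow> complex" where
  "herm u v = (\<Sum>i\<in>UNIV. u $ i * cnj (v $ i))"

lemma outer_mult: "outer u v ** outer w z = outer (herm w v *s u) z"
  by (simp add: outer_def herm_def matrix_matrix_mult_def vec_eq_iff sum_distrib_left
      sum_distrib_right algebra_simps)

lemma Re_herm: "Re (herm u v) = u \<bullet> v"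
  by (simp add: herm_def inner_vec_def inner_complex_def)

lemma herm_self: "herm v v = complex_of_real ((norm v)\<^sup>2)"
proof -
  have "Im (herm v v) = 0"
    by (simp add: herm_def mult.commute)
  then show ?thesis
    by (simp add: complex_eq_iff Re_herm power2_norm_eq_inner)
qed

lemma herm_commute: "herm v u = cnj (herm u v)"
  by (simp add: herm_def mult.commute)

lemma hopf_eq_iff:
  assumes "norm v = 1" "norm w = 1"
  shows "hopf v = hopf w \<longleftrightarrow> (\<exists>c. cmod c = 1 \<and> w = c *s v)"
proof
  assume eq: "hopf v = hopf w"
  have w: "outer (herm w w *s w) w = outer (herm w v *s v) w"
  proof -
    have "hopf w ** hopf w = hopf v ** hopf w" by (simp add: eq)
    then show ?thesis by (simp add: hopf_def outer_mult)
  qed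
  have "w \<noteq> 0" using assms(2) by auto
  then obtain j where j: "w $ j \<noteq> 0"
    by (auto simp: vec_eq_iff)
  have wv: "w = herm w v *s v"
  proof -
    have "w $ i * cnj (w $ j) = (herm w v *s v) $ i * cnj (w $ j)" for i
      using arg_cong [OF w, of "\<lambda>M. M $ i $ j"] assms(2) by (simp add: outer_def herm_self)
    then show ?thesis using j by (simp add: vec_eq_iff)
  qed
  have "herm w w = herm w v * cnj (herm w v) * herm v v"
  proof -
    have "herm (c *s v) (c *s v) = c * cnj c * herm v v" for c
      by (simp add: herm_def sum_distrib_left algebra_simps)
    from this [of "herm w v"] show ?thesis unfolding wv [symmetric] .
  qed
  then have "complex_of_real ((cmod (herm w v))\<^sup>2) = 1"
    using assms by (simp add: herm_self complex_norm_square del: of_real_power)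
  then have "(cmod (herm w v))\<^sup>2 = 1"
    by (metis of_real_eq_1_iff)
  then have "cmod (herm w v) = 1"
    by (smt (verit) norm_ge_zero power2_eq_1_iff)
  with wv show "\<exists>c. cmod c = 1 \<and> w = c *s v" by blast
next
  assume "\<exists>c. cmod c = 1 \<and> w = c *s v"
  then obtain c where c: "cmod c = 1" "w = c *s v" by blast
  have "c * cnj c = 1" using c(1) by (simp add: complex_norm_square [symmetric])
  then have "c * x * (cnj c * y) = x * y" for x y
    by (simp add: mult.assoc mult.left_commute)
  then show "hopf v = hopf w"
    by (simp add: c(2) hopf_def outer_def vec_eq_iff)
qed

lemma bounded_bilinear_outer: "bounded_bilinear (outer :: complex^'n \<Rightarrow> _)"
proof -
  have "bilinear (outer :: complex^'n \<Rightarrow> _)"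
    unfolding bilinear_def linear_iff
    by (simp add: outer_def vec_eq_iff distrib_left distrib_right complex_cnj_scaleR)
  then show ?thesis by (simp add: bilinear_conv_bounded_bilinear)
qed

text \<open>
  On the horizontal space at \<open>v\<close>, the complex orthogonal complement of \<open>v\<close>, the derivative of the
  Hopf map is isometric and complex linear.
\<close>

lemma hopf_has_derivative:
  "(hopf has_derivative (\<lambda>u. outer u v + outer v u)) (at v)"
  unfolding hopf_def [abs_def]
  using bounded_bilinear.FDERIV [OF bounded_bilinear_outer has_derivative_ident has_derivative_ident, of v UNIV]
  by (simp add: add.commute)

lemma inner_matrix: "A \<bullet> X = Re (\<Sum>i\<in>UNIV. \<Sum>j\<in>UNIV. A $ i $ j * cnj (X $ i $ j))"
  for A X :: "complex^'n^'n"
  by (simp add: inner_vec_def inner_complex_def)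

lemma inner_outer: "outer a b \<bullet> outer c d = Re (herm a c * cnj (herm b d))"
proof -
  have "herm a c * cnj (herm b d) =
      (\<Sum>i\<in>UNIV. \<Sum>j\<in>UNIV. (a $ i * cnj (c $ i)) * cnj (b $ j * cnj (d $ j)))"
    by (simp only: herm_def cnj_sum sum_product)
  also have "\<dots> = (\<Sum>i\<in>UNIV. \<Sum>j\<in>UNIV. outer a b $ i $ j * cnj (outer c d $ i $ j))"
    by (simp add: outer_def mult_ac)
  finally show ?thesis by (simp only: inner_matrix)
qed

lemma fs_metric_hopf:
  assumes "norm v = 1" "herm u v = 0" "herm w v = 0"
  shows "fs_metric (outer u v + outer v u) (outer w v + outer v w) = u \<bullet> w"
proof -
  have "herm v u = 0" "herm v w = 0"
    using assms(2,3) by (simp_all add: herm_commute [of v])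
  then show ?thesis
    using assms by (simp add: fs_metric_def inner_add_left inner_add_right inner_outer herm_self Re_herm)
qed

lemma cplx_str_hopf:
  assumes "norm v = 1" "herm u v = 0"
  shows "cplx_str (hopf v) (outer u v + outer v u) = outer (\<i> *s u) v + outer v (\<i> *s u)"
proof -
  have "herm v u = 0"
    using assms(2) by (simp add: herm_commute [of v])
  have *: "mat \<i> ** M = (\<chi> i j. \<i> * M $ i $ j)" for M :: "complex^'a^'a"
    by (simp add: matrix_matrix_mult_def mat_def vec_eq_iff if_distrib [of "\<lambda>x. x * _"] cong: if_cong)
  have "outer 0 v = 0" for v :: "complex^'a" by (simp add: outer_def vec_eq_iff)
  then show ?thesis
    using assms \<open>herm v u = 0\<close>
    by (simp add: cplx_str_def hopf_def matrix_distribs outer_mult herm_self * del: vector_scalar_mult_def)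
      (simp add: outer_def vec_eq_iff algebra_simps)
qed

lemma cproj_idem:
  assumes "P \<in> cproj"
  shows "ctransp P = P" "P ** P = P"
  using assms by (auto simp: cproj_def hopf_def ctransp_outer outer_mult herm_self)

lemma tangent_corner_zero:
  assumes "P \<in> cproj" "X \<in> tangent_cproj P"
  shows "P ** X ** P = 0"
proof -
  have "P ** X = P ** (P ** X + X ** P)"
    using assms(2) by (simp add: tangent_cproj_def)
  also have "\<dots> = P ** X + P ** X ** P"
    using cproj_idem [OF assms(1)] by (simp add: matrix_distribs matrix_mul_assoc)
  finally show ?thesis by simp
qed

lemma tproj_tangent:
  assumes "P \<in> cproj" "X \<in> tangent_cproj P"
  shows "tproj P X = X"
  using tangent_corner_zero [OF assms] assms(2)
  by (simp add: tproj_def matrix_distribs tangent_cproj_def matrix_mul_assoc)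

lemma tproj_in_tangent:
  fixes P A :: "complex^'n^'n"
  assumes "P \<in> cproj" "ctransp A = A"
  shows "tproj P A \<in> tangent_cproj P"
proof -
  note P = cproj_idem [OF assms(1)]
  define Q where "Q = mat 1 - P"
  have "ctransp (mat 1 :: complex^'n^'n) = mat 1"
    by (simp add: ctransp_def mat_def vec_eq_iff)
  then have Q: "ctransp Q = Q" "P ** Q = 0" "Q ** P = 0"
    using P by (simp_all add: Q_def ctransp_diff matrix_distribs)
  have T: "tproj P A = P ** A ** Q + Q ** A ** P"
    by (simp add: tproj_def Q_def)
  have "ctransp (tproj P A) = tproj P A"
    by (simp add: T ctransp_add ctransp_mult assms(2) P Q matrix_mul_assoc add.commute)
  moreover have "P ** tproj P A = P ** A ** Q"
    by (simp add: T matrix_distribs matrix_mul_assoc P Q)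
  moreover have "tproj P A ** P = Q ** A ** P"
    by (simp add: T matrix_distribs P Q flip: matrix_mul_assoc)
  ultimately show ?thesis
    by (simp add: tangent_cproj_def T)
qed

lemma inner_mult_left: "(M ** A) \<bullet> X = A \<bullet> (ctransp M ** X)"
  for M A X :: "complex^'n^'n"
proof -
  have 1: "(M ** A) \<bullet> X = Re (\<Sum>i\<in>UNIV. \<Sum>j\<in>UNIV. \<Sum>k\<in>UNIV. M $ i $ k * A $ k $ j * cnj (X $ i $ j))"
    by (subst inner_matrix) (simp only: matrix_matrix_mult_def vec_lambda_beta sum_distrib_right)
  have 2: "A \<bullet> (ctransp M ** X) = Re (\<Sum>k\<in>UNIV. \<Sum>j\<in>UNIV. \<Sum>i\<in>UNIV. M $ i $ k * A $ k $ j * cnj (X $ i $ j))"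
    by (subst inner_matrix) (simp only: matrix_matrix_mult_def ctransp_def vec_lambda_beta cnj_sum
        sum_distrib_left complex_cnj_mult complex_cnj_cnj mult.assoc mult.left_commute)
  have "(\<Sum>i\<in>UNIV. \<Sum>j\<in>UNIV. \<Sum>k\<in>UNIV. M $ i $ k * A $ k $ j * cnj (X $ i $ j)) =
        (\<Sum>j\<in>UNIV. \<Sum>i\<in>UNIV. \<Sum>k\<in>UNIV. M $ i $ k * A $ k $ j * cnj (X $ i $ j))"
    by (rule sum.swap)
  also have "\<dots> = (\<Sum>j\<in>UNIV. \<Sum>k\<in>UNIV. \<Sum>i\<in>UNIV. M $ i $ k * A $ k $ j * cnj (X $ i $ j))"
    by (intro sum.cong refl sum.swap)
  also have "\<dots> = (\<Sum>k\<in>UNIV. \<Sum>j\<in>UNIV. \<Sum>i\<in>UNIV. M $ i $ k * A $ k $ j * cnj (X $ i $ j))"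
    by (rule sum.swap)
  finally show ?thesis using 1 2 by simp
qed

lemma inner_ctransp: "ctransp A \<bullet> ctransp B = A \<bullet> B"
  unfolding inner_vec_def
  by (simp add: ctransp_def inner_complex_def) (rule sum.swap)

lemma inner_mult_right: "(A ** M) \<bullet> X = A \<bullet> (X ** ctransp M)"
  for M A X :: "complex^'n^'n"
  using inner_mult_left [of "ctransp M" "ctransp A" "ctransp X"]
    inner_ctransp [of "A ** M" X] inner_ctransp [of A "X ** ctransp M"]
  by (simp add: ctransp_mult)

lemma tproj_orthogonal:
  assumes "P \<in> cproj" "X \<in> tangent_cproj P"
  shows "(A - tproj P A) \<bullet> X = 0"
proof -
  note P = cproj_idem [OF assms(1)]
  have tp: "tproj P M = P ** M + M ** P - P ** M ** P - P ** M ** P" for M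
    by (simp add: tproj_def matrix_distribs matrix_mul_assoc)
  have "(P ** A) \<bullet> X = A \<bullet> (P ** X)" "(A ** P) \<bullet> X = A \<bullet> (X ** P)"
    using inner_mult_left [of P A X] inner_mult_right [of A P X] P by simp_all
  moreover have "(P ** A ** P) \<bullet> X = A \<bullet> (P ** X ** P)"
    using inner_mult_left [of P A "X ** P"] inner_mult_right [of "P ** A" P X] P
    by (simp add: matrix_mul_assoc)
  ultimately have "tproj P A \<bullet> X = A \<bullet> tproj P X"
    by (simp only: tp inner_add_left inner_add_right inner_diff_left inner_diff_right)
  then show ?thesis
    by (simp add: tproj_tangent [OF assms] inner_diff_left)
qed


section \<open>Curves\<close>

definition nondeg_interval :: "real set \<Rightarrow> bool" where
  "nondeg_interval I \<longleftrightarrow> is_interval I \<and> interior I \<noteq> {}"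

text \<open>Infinitely differentiable on \<open>I\<close>, with one-sided derivatives at end points belonging to \<open>I\<close>;
  \<open>F k\<close> is the derivative of order \<open>k\<close>.\<close>

definition smooth_curve :: "real set \<Rightarrow> (real \<Rightarrow> 'a::real_normed_vector) \<Rightarrow> bool" where
  "smooth_curve I f \<longleftrightarrow>
     (\<exists>F :: nat \<Rightarrow> real \<Rightarrow> 'a. (\<forall>t\<in>I. F 0 t = f t) \<and>
        (\<forall>k. \<forall>t\<in>I. (F k has_vector_derivative F (Suc k) t) (at t within I)))"

definition curve_in_cproj :: "real set \<Rightarrow> (real \<Rightarrow> complex^'n^'n) \<Rightarrow> bool" where
  "curve_in_cproj I \<gamma> \<longleftrightarrow> nondeg_interval I \<and> smooth_curve I \<gamma> \<and> (\<forall>t\<in>I. \<gamma> t \<in> cproj)"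

definition field_along :: "real set \<Rightarrow> (real \<Rightarrow> complex^'n^'n) \<Rightarrow> (real \<Rightarrow> complex^'n^'n) \<Rightarrow> bool" where
  "field_along I \<gamma> V \<longleftrightarrow> smooth_curve I V \<and> (\<forall>t\<in>I. V t \<in> tangent_cproj (\<gamma> t))"

definition velocity :: "real set \<Rightarrow> (real \<Rightarrow> complex^'n^'n) \<Rightarrow> real \<Rightarrow> complex^'n^'n" where
  "velocity I \<gamma> t = vector_derivative \<gamma> (at t within I)"

definition cov_along ::
  "real set \<Rightarrow> (real \<Rightarrow> complex^'n^'n) \<Rightarrow> (real \<Rightarrow> complex^'n^'n) \<Rightarrow> real \<Rightarrow> complex^'n^'n" where
  "cov_along I \<gamma> V t = tproj (\<gamma> t) (vector_derivative V (at t within I))"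

text \<open>
  For a map from an interval with its flat metric the traces in the tension field, the rough
  Laplacian and the bitension field have the single term given by the unit field d/dt, which is
  parallel.
\<close>

definition tension :: "real set \<Rightarrow> (real \<Rightarrow> complex^'n^'n) \<Rightarrow> real \<Rightarrow> complex^'n^'n" where
  "tension I \<gamma> = cov_along I \<gamma> (velocity I \<gamma>)"

definition rough_laplacian ::
  "real set \<Rightarrow> (real \<Rightarrow> complex^'n^'n) \<Rightarrow> (real \<Rightarrow> complex^'n^'n) \<Rightarrow> real \<Rightarrow> complex^'n^'n" where
  "rough_laplacian I \<gamma> V t = - cov_along I \<gamma> (cov_along I \<gamma> V) t"

definition bitension :: "real set \<Rightarrow> (real \<Rightarrow> complex^'n^'n) \<Rightarrow> real \<Rightarrow> complex^'n^'n" where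
  "bitension I \<gamma> t =
     - rough_laplacian I \<gamma> (tension I \<gamma>) t
       - curv (\<gamma> t) (velocity I \<gamma> t) (tension I \<gamma> t) (velocity I \<gamma> t)"

definition harmonic_curve :: "real set \<Rightarrow> (real \<Rightarrow> complex^'n^'n) \<Rightarrow> bool" where
  "harmonic_curve I \<gamma> \<longleftrightarrow> curve_in_cproj I \<gamma> \<and> (\<forall>t\<in>I. tension I \<gamma> t = 0)"

definition biharmonic_curve :: "real set \<Rightarrow> (real \<Rightarrow> complex^'n^'n) \<Rightarrow> bool" where
  "biharmonic_curve I \<gamma> \<longleftrightarrow> curve_in_cproj I \<gamma> \<and> (\<forall>t\<in>I. bitension I \<gamma> t = 0)"

definition proper_biharmonic :: "real set \<Rightarrow> (real \<Rightarrow> complex^'n^'n) \<Rightarrow> bool" where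
  "proper_biharmonic I \<gamma> \<longleftrightarrow> biharmonic_curve I \<gamma> \<and> \<not> harmonic_curve I \<gamma>"

text \<open>
  \<open>E 1, \<dots>, E d\<close> is the Frenet frame and \<open>k 1, \<dots>, k (d - 1)\<close> are the curvatures; other indices are
  irrelevant. The index type has one element more than the complex dimension. Parametrization by
  arc length is part of the condition, as \<open>E 1\<close> is the velocity and has length 1.
\<close>

definition frenet_curve ::
  "real set \<Rightarrow> (real \<Rightarrow> complex^'n^'n) \<Rightarrow> nat \<Rightarrow> (nat \<Rightarrow> real \<Rightarrow> complex^'n^'n) \<Rightarrow> (nat \<Rightarrow> real \<Rightarrow> real) \<Rightarrow> bool" where
  "frenet_curve I \<gamma> d E k \<longleftrightarrow>
     curve_in_cproj I \<gamma> \<and> 1 \<le> d \<and> d \<le> 2 * (CARD('n) - 1) \<and>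
     (\<forall>i\<in>{1..d}. field_along I \<gamma> (E i)) \<and>
     (\<forall>i\<in>{1..d}. \<forall>j\<in>{1..d}. \<forall>t\<in>I. fs_metric (E i t) (E j t) = (if i = j then 1 else 0)) \<and>
     (\<forall>i\<in>{1..<d}. \<forall>t\<in>I. 0 < k i t) \<and>
     (\<forall>t\<in>I. E 1 t = velocity I \<gamma> t) \<and>
     (\<forall>i\<in>{1..d}. \<forall>t\<in>I. cov_along I \<gamma> (E i) t =
        (if i = 1 then 0 else - (k (i - 1) t *\<^sub>R E (i - 1) t)) +
        (if i = d then 0 else k i t *\<^sub>R E (i + 1) t))"

definition helix ::
  "real set \<Rightarrow> (real \<Rightarrow> complex^'n^'n) \<Rightarrow> nat \<Rightarrow> (nat \<Rightarrow> real \<Rightarrow> complex^'n^'n) \<Rightarrow> (nat \<Rightarrow> real \<Rightarrow> real) \<Rightarrow> bool" where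
  "helix I \<gamma> d E k \<longleftrightarrow> frenet_curve I \<gamma> d E k \<and> (\<forall>i\<in>{1..<d}. k i constant_on I)"

definition ctorsion ::
  "(real \<Rightarrow> complex^'n^'n) \<Rightarrow> (nat \<Rightarrow> real \<Rightarrow> complex^'n^'n) \<Rightarrow> nat \<Rightarrow> nat \<Rightarrow> real \<Rightarrow> real" where
  "ctorsion \<gamma> E i j t = fs_metric (E i t) (cplx_str (\<gamma> t) (E j t))"

definition holomorphic_helix ::
  "real set \<Rightarrow> (real \<Rightarrow> complex^'n^'n) \<Rightarrow> nat \<Rightarrow> (nat \<Rightarrow> real \<Rightarrow> complex^'n^'n) \<Rightarrow> (nat \<Rightarrow> real \<Rightarrow> real) \<Rightarrow> bool" where
  "holomorphic_helix I \<gamma> d E k \<longleftrightarrow>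
     helix I \<gamma> d E k \<and> (\<forall>i j. 1 \<le> i \<and> i < j \<and> j \<le> d \<longrightarrow> ctorsion \<gamma> E i j constant_on I)"

definition helix_nu :: "(nat \<Rightarrow> real \<Rightarrow> real) \<Rightarrow> real \<Rightarrow> real" where
  "helix_nu k t = (k 1 t - k 3 t) / sqrt ((k 2 t)\<^sup>2 + (k 1 t - k 3 t)\<^sup>2)"

definition class_I3 ::
  "real set \<Rightarrow> (real \<Rightarrow> complex^3^3) \<Rightarrow> (nat \<Rightarrow> real \<Rightarrow> complex^3^3) \<Rightarrow> (nat \<Rightarrow> real \<Rightarrow> real) \<Rightarrow> bool" where
  "class_I3 I \<gamma> E k \<longleftrightarrow>
     holomorphic_helix I \<gamma> 4 E k \<and>
     (\<forall>t\<in>I. k 1 t \<noteq> k 3 t \<and>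
        ctorsion \<gamma> E 1 2 t = helix_nu k t \<and>
        - ctorsion \<gamma> E 3 4 t = helix_nu k t \<and>
        ctorsion \<gamma> E 2 3 t = k 2 t * helix_nu k t / (k 1 t - k 3 t) \<and>
        - ctorsion \<gamma> E 1 4 t = k 2 t * helix_nu k t / (k 1 t - k 3 t) \<and>
        ctorsion \<gamma> E 1 3 t = 0 \<and> ctorsion \<gamma> E 2 4 t = 0)"

definition class_I4 ::
  "real set \<Rightarrow> (real \<Rightarrow> complex^3^3) \<Rightarrow> (nat \<Rightarrow> real \<Rightarrow> complex^3^3) \<Rightarrow> (nat \<Rightarrow> real \<Rightarrow> real) \<Rightarrow> bool" where
  "class_I4 I \<gamma> E k \<longleftrightarrow>
     holomorphic_helix I \<gamma> 4 E k \<and>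
     (\<forall>t\<in>I. k 1 t \<noteq> k 3 t \<and>
        ctorsion \<gamma> E 1 2 t = - helix_nu k t \<and>
        - ctorsion \<gamma> E 3 4 t = - helix_nu k t \<and>
        ctorsion \<gamma> E 2 3 t = - (k 2 t * helix_nu k t / (k 1 t - k 3 t)) \<and>
        - ctorsion \<gamma> E 1 4 t = - (k 2 t * helix_nu k t / (k 1 t - k 3 t)) \<and>
        ctorsion \<gamma> E 1 3 t = 0 \<and> ctorsion \<gamma> E 2 4 t = 0)"

text \<open>
  The sign of the second complex torsion distinguishes the two classes, whatever the sign of
  \<open>k 1 - k 3\<close>.
\<close>

lemma class_I3_ctorsion_pos:
  assumes "class_I3 I \<gamma> E k" "t \<in> I"
  shows "0 < ctorsion \<gamma> E 2 3 t"
proof -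
  have k: "k 1 t \<noteq> k 3 t" "0 < k 2 t"
    "ctorsion \<gamma> E 2 3 t = k 2 t * helix_nu k t / (k 1 t - k 3 t)"
    using assms by (auto simp: class_I3_def holomorphic_helix_def helix_def frenet_curve_def)
  then have "0 < sqrt ((k 2 t)\<^sup>2 + (k 1 t - k 3 t)\<^sup>2)"
    by (simp add: add_pos_nonneg)
  with k show ?thesis by (simp add: helix_nu_def del: real_sqrt_gt_0_iff)
qed

lemma class_I4_ctorsion_neg:
  assumes "class_I4 I \<gamma> E k" "t \<in> I"
  shows "ctorsion \<gamma> E 2 3 t < 0"
proof -
  have k: "k 1 t \<noteq> k 3 t" "0 < k 2 t"
    "ctorsion \<gamma> E 2 3 t = - (k 2 t * helix_nu k t / (k 1 t - k 3 t))"
    using assms by (auto simp: class_I4_def holomorphic_helix_def helix_def frenet_curve_def)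
  then have "0 < sqrt ((k 2 t)\<^sup>2 + (k 1 t - k 3 t)\<^sup>2)"
    by (simp add: add_pos_nonneg)
  with k show ?thesis by (simp add: helix_nu_def del: real_sqrt_gt_0_iff)
qed

text \<open>
  Biharmonicity leads to the equation \<open>y\<^sup>2 - (1 - 3 cos\<^sup>2 \<alpha>) y + 9 cos\<^sup>2 \<alpha> = 0\<close> for
  \<open>y = (k 2 / sin \<alpha>)\<^sup>2\<close>, with this discriminant. The library function \<open>sqrt\<close> is total (odd), so a
  formula containing \<open>sqrt (inner_radicand \<alpha>)\<close> has its usual meaning only where this is
  nonnegative.
\<close>

definition inner_radicand :: "real \<Rightarrow> real" where
  "inner_radicand \<alpha> = 9 * (cos \<alpha>)^4 - 42 * (cos \<alpha>)\<^sup>2 + 1"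

end

theory Submission
  imports Defs
begin

text \<open>
  For a Frenet curve of order 4 in the complex projective plane the biharmonic equation can be
  written out in the Frenet frame. All that enters from the ambient space is the value
  \<open>R(X, Y)X = - Y + 3 \<langle>X, JY\<rangle> JX\<close> of the curvature on orthonormal X, Y (\<open>curv_orthonormal\<close>). The
  components are \<open>k\<^sub>1' = 0\<close>, \<open>k\<^sub>1\<^sup>2 + k\<^sub>2\<^sup>2 = 1 + 3 \<tau>\<^sub>1\<^sub>2\<^sup>2\<close>, \<open>k\<^sub>2' = - 3 \<tau>\<^sub>1\<^sub>2 \<tau>\<^sub>1\<^sub>3\<close> and
  \<open>k\<^sub>2 k\<^sub>3 = - 3 \<tau>\<^sub>1\<^sub>2 \<tau>\<^sub>1\<^sub>4\<close> (\<open>bitension_zero_components\<close>).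

  As J is parallel, the complex torsions satisfy a linear system; in particular
  \<open>\<tau>\<^sub>1\<^sub>2' = k\<^sub>2 \<tau>\<^sub>1\<^sub>3\<close>. Differentiating the second component gives \<open>k\<^sub>2' = 3 \<tau>\<^sub>1\<^sub>2 \<tau>\<^sub>1\<^sub>3\<close>, the negative of
  the third one, so \<open>\<tau>\<^sub>1\<^sub>2 \<tau>\<^sub>1\<^sub>3 = 0\<close>. The fourth component and positivity of the curvatures exclude
  \<open>\<tau>\<^sub>1\<^sub>2 = 0\<close>, hence \<open>\<tau>\<^sub>1\<^sub>3 = 0\<close>. The real dimension being 4, the torsions are the entries of a skew
  orthogonal matrix; the equation \<open>\<tau>\<^sub>1\<^sub>3' = 0\<close> and the sign of \<open>\<tau>\<^sub>1\<^sub>2 \<tau>\<^sub>1\<^sub>4\<close> single out one of its two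
  possible shapes (\<open>torsion_matrix_algebra\<close>), which has \<open>k\<^sub>1 > k\<^sub>3\<close> and determines all torsions up to
  one common sign: this sign is the class. Everything is then constant
  (\<open>proper_biharmonic_order4\<close>).

  For the converse, the helices are orbits of one-parameter groups of unitary matrices. Along such
  an orbit the Frenet equations reduce to identities between constant matrices at one point, and a
  generator with prescribed curvatures and torsions \<open>\<tau>\<^sub>1\<^sub>2 = c\<close>, \<open>\<tau>\<^sub>2\<^sub>3 = s\<close> can be written down as soon as
  \<open>(k\<^sub>1 - k\<^sub>3) s = k\<^sub>2 c\<close> (\<open>homogeneous_biharmonic_helix\<close>). With \<open>c = - cos \<alpha>\<close> and \<open>s = sin \<alpha>\<close> this relation
  and the equation for \<open>k\<^sub>2 k\<^sub>3\<close> express \<open>k\<^sub>1\<close> and \<open>k\<^sub>3\<close> by \<open>k\<^sub>2\<close>, and the remaining equation becomes a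
  quadratic equation for \<open>(k\<^sub>2 / s)\<^sup>2\<close>. It has two positive roots, and the class of the resulting
  curve is read off from the sign of \<open>c\<close> by the direct part.
\<close>

section \<open>The curvature tensor as a double commutator\<close>

lemma bounded_bilinear_matrix_mult: "bounded_bilinear ((**) :: complex^'n^'n \<Rightarrow> complex^'n^'n \<Rightarrow> complex^'n^'n)"
proof -
  have "bilinear ((**) :: complex^'n^'n \<Rightarrow> complex^'n^'n \<Rightarrow> complex^'n^'n)"
    unfolding bilinear_def linear_iff
    by (simp add: matrix_distribs matrix_matrix_mult_def vec_eq_iff scaleR_sum_right
        sum.distrib distrib_left distrib_right)
  then show ?thesis by (simp add: bilinear_conv_bounded_bilinear)
qed

lemmas matrix_mult_has_derivative [derivative_intros] =
  bounded_bilinear.FDERIV [OF bounded_bilinear_matrix_mult]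

lemmas matrix_mult_has_vector_derivative =
  bounded_bilinear.has_vector_derivative [OF bounded_bilinear_matrix_mult]

lemma matrix_scaleR_left: "(r *\<^sub>R A) ** B = r *\<^sub>R (A ** B)" for A B :: "complex^'n^'n"
  by (rule bounded_bilinear.scaleR_left [OF bounded_bilinear_matrix_mult])

lemma matrix_scaleR_right: "A ** (r *\<^sub>R B) = r *\<^sub>R (A ** B)" for A B :: "complex^'n^'n"
  by (rule bounded_bilinear.scaleR_right [OF bounded_bilinear_matrix_mult])

lemma matrix_minus_left: "(- A) ** B = - (A ** B)" for A B :: "complex^'n^'n"
  by (rule bounded_bilinear.minus_left [OF bounded_bilinear_matrix_mult])

lemma matrix_minus_right: "A ** (- B) = - (A ** B)" for A B :: "complex^'n^'n"
  by (rule bounded_bilinear.minus_right [OF bounded_bilinear_matrix_mult])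

lemmas matrix_zero =
  bounded_bilinear.zero_left [OF bounded_bilinear_matrix_mult]
  bounded_bilinear.zero_right [OF bounded_bilinear_matrix_mult]

lemmas matrix_algebra =
  matrix_distribs matrix_scaleR_left matrix_scaleR_right matrix_minus_left matrix_minus_right
  matrix_mul_assoc

lemma tproj_alt: "tproj P A = P ** A + A ** P - (P ** A ** P + P ** A ** P)"
  by (simp add: tproj_def matrix_algebra)

text \<open>
  The derivative of \<open>\<lambda>Q. tproj Q A\<close> at \<open>Q\<close> in the direction \<open>H\<close>.
\<close>

definition dtproj :: "complex^'n^'n \<Rightarrow> complex^'n^'n \<Rightarrow> complex^'n^'n \<Rightarrow> complex^'n^'n" where
  "dtproj Q H A = H ** A + A ** H - (H ** A ** Q + H ** A ** Q + Q ** A ** H + Q ** A ** H)"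

lemma tproj_has_derivative:
  assumes "(f has_derivative f') (at P)" "(g has_derivative g') (at P)"
  shows "((\<lambda>Q. tproj (f Q) (g Q)) has_derivative
    (\<lambda>h. dtproj (f P) (f' h) (g P) + tproj (f P) (g' h))) (at P)"
  unfolding tproj_alt
  by (rule has_derivative_eq_rhs, (rule derivative_intros assms)+)
    (simp add: fun_eq_iff dtproj_def tproj_alt matrix_algebra algebra_simps)

lemma dtproj_has_derivative:
  assumes "(f has_derivative f') (at P)"
  shows "((\<lambda>Q. dtproj Q (f Q) A) has_derivative
    (\<lambda>h. dtproj P (f' h) A - (f P ** A ** h + f P ** A ** h + h ** A ** f P + h ** A ** f P))) (at P)"
  unfolding dtproj_def
  by (rule has_derivative_eq_rhs, (rule derivative_intros assms)+)
    (simp add: fun_eq_iff matrix_algebra algebra_simps)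

lemma tproj_const_derivative:
  "((\<lambda>Q. tproj Q A) has_derivative (\<lambda>h. dtproj P h A)) (at P)"
  using tproj_has_derivative [of "\<lambda>Q. Q" "\<lambda>h. h" P "\<lambda>_. A" "\<lambda>_. 0"]
  by (simp add: tproj_def matrix_zero)

lemma cov_deriv_tproj:
  "cov_deriv (\<lambda>Q. tproj Q Y) (\<lambda>Q. tproj Q Z) = (\<lambda>Q. tproj Q (dtproj Q (tproj Q Y) Z))"
  by (rule ext) (simp add: cov_deriv_def frechet_derivative_at [OF tproj_const_derivative, symmetric])

text \<open>
  The last summand comes from the second derivative of \<open>\<lambda>Q. tproj Q Z\<close>. It is symmetric in \<open>X\<close> and
  \<open>Y\<close> and so drops out of the curvature.
\<close>

lemma cov_deriv_cov_deriv_tproj: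
  "cov_deriv (\<lambda>Q. tproj Q X) (cov_deriv (\<lambda>Q. tproj Q Y) (\<lambda>Q. tproj Q Z)) P =
    tproj P (dtproj P (tproj P X) (dtproj P (tproj P Y) Z)
      + tproj P (dtproj P (dtproj P (tproj P X) Y) Z
          - (tproj P Y ** Z ** tproj P X + tproj P Y ** Z ** tproj P X
               + tproj P X ** Z ** tproj P Y + tproj P X ** Z ** tproj P Y)))"
  unfolding cov_deriv_tproj
  unfolding cov_deriv_def
  by (simp add: frechet_derivative_at [OF tproj_has_derivative [OF has_derivative_ident
        dtproj_has_derivative [OF tproj_const_derivative]], symmetric])

lemma tproj_add: "tproj P (A + B) = tproj P A + tproj P B"
  by (simp add: tproj_def matrix_distribs)

lemma tproj_diff: "tproj P (A - B) = tproj P A - tproj P B"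
  by (simp add: tproj_def matrix_distribs)

lemma dtproj_diff: "dtproj P (A - B) C = dtproj P A C - dtproj P B C"
  by (simp add: dtproj_def matrix_distribs)

lemma tproj_idem:
  fixes P :: "complex^'n^'n"
  assumes "P ** P = P" shows "tproj P (tproj P A) = tproj P A"
proof -
  define N where "N = mat 1 - P"
  have [simp]: "B ** P ** P = B ** P" "B ** N ** N = B ** N" "B ** P ** N = 0" "B ** N ** P = 0"
    for B :: "complex^'n^'n"
    using assms by (simp_all add: N_def matrix_distribs flip: matrix_mul_assoc)
  have [simp]: "N ** N = N" "P ** N = 0" "N ** P = 0"
    using assms by (simp_all add: N_def matrix_distribs)
  show ?thesis
    by (simp add: tproj_def N_def [symmetric] matrix_algebra matrix_zero assms)
qed

text \<open>
  Tangent vectors are block off-diagonal with respect to \<open>P\<close> and \<open>mat 1 - P\<close>. As rewrite rules these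
  equations move \<open>P\<close> to the left through a product of tangent vectors, which gives normal forms.
\<close>

lemma tangent_cproj_swap:
  fixes P M :: "complex^'n^'n"
  assumes "X \<in> tangent_cproj P"
  shows "X ** P = X - P ** X" "M ** X ** P = M ** X - M ** P ** X"
proof -
  show *: "X ** P = X - P ** X"
    using assms by (auto simp: tangent_cproj_def algebra_simps)
  show "M ** X ** P = M ** X - M ** P ** X"
    using arg_cong [OF *, of "\<lambda>S. M ** S"] by (simp add: matrix_algebra)
qed

lemma cproj_idem_right:
  fixes P M :: "complex^'n^'n"
  assumes "P \<in> cproj"
  shows "M ** P ** P = M ** P"
  using cproj_idem(2) [OF assms] by (simp flip: matrix_mul_assoc)

text \<open>
  In \<open>\<nabla>\<^sub>X \<nabla>\<^sub>Y Z - \<nabla>\<^sub>Y \<nabla>\<^sub>X Z\<close> the terms that differentiate the inner field \<open>X\<close> or \<open>Y\<close> cancel against the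
  Lie bracket term. What remains comes from differentiating the outer projection. A product of two
  tangent vectors is block diagonal, so it commutes with \<open>P\<close>, and each remaining term is an iterated
  anticommutator \<open>{X, {Y, Z}}\<close>; finally \<open>{X, {Y, Z}} - {Y, {X, Z}} = [[X, Y], Z]\<close>.
\<close>

lemma curv_eq_commutator:
  fixes P :: "complex^'n^'n"
  assumes P: "P \<in> cproj" and T: "X \<in> tangent_cproj P" "Y \<in> tangent_cproj P" "Z \<in> tangent_cproj P"
  shows "curv P X Y Z = (X ** Y - Y ** X) ** Z - Z ** (X ** Y - Y ** X)"
proof -
  note I = cproj_idem [OF P]
  have br: "lie_bracket (\<lambda>Q. tproj Q X) (\<lambda>Q. tproj Q Y) P = dtproj P X Y - dtproj P Y X"
    by (simp add: lie_bracket_def frechet_derivative_at [OF tproj_const_derivative, symmetric] tproj_tangent [OF P] T)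
  have cb: "cov_deriv (lie_bracket (\<lambda>Q. tproj Q X) (\<lambda>Q. tproj Q Y)) (\<lambda>Q. tproj Q Z) P
    = tproj P (dtproj P (dtproj P X Y - dtproj P Y X) Z)"
    by (simp add: cov_deriv_def br frechet_derivative_at [OF tproj_const_derivative, symmetric])
  have "curv P X Y Z = tproj P (dtproj P X (dtproj P Y Z)) - tproj P (dtproj P Y (dtproj P X Z))"
    unfolding curv_def curv_field_def cov_deriv_cov_deriv_tproj cb
    by (simp add: tproj_tangent [OF P] T tproj_add tproj_diff tproj_idem I)
      (simp add: dtproj_diff tproj_diff algebra_simps)
  moreover have "tproj P (dtproj P A (dtproj P B C)) = A ** (B ** C + C ** B) + (B ** C + C ** B) ** A"
    if t: "A \<in> tangent_cproj P" "B \<in> tangent_cproj P" "C \<in> tangent_cproj P" for A B C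
  proof -
    note PP = cproj_idem_right [OF P]
    note sw1 = tangent_cproj_swap [OF t(1)] and sw2 = tangent_cproj_swap [OF t(2)]
      and sw3 = tangent_cproj_swap [OF t(3)]
    define D where "D = B ** C + C ** B"
    have DP: "D ** P = P ** D" "M ** D ** P = M ** P ** D" for M :: "complex^'n^'n"
    proof -
      show "D ** P = P ** D"
        by (simp only: D_def matrix_algebra sw2 sw3)
          (simp add: algebra_simps)
      then show "M ** D ** P = M ** P ** D" for M :: "complex^'n^'n"
        by (simp flip: matrix_mul_assoc)
    qed
    \<comment> \<open>\<open>dtproj P B C = (1 - 2P) D\<close>, and \<open>1 - 2P\<close> anticommutes with tangent vectors\<close>
    have W: "dtproj P B C = D - (P ** D + P ** D)"
      by (simp only: D_def dtproj_def matrix_algebra sw2 sw3)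
        (simp add: algebra_simps)
    have "dtproj P A (dtproj P B C) = A ** D + D ** A"
      unfolding W
      by (simp only: dtproj_def matrix_algebra DP I PP sw1) (simp add: algebra_simps)
    moreover have "tproj P (A ** D + D ** A) = A ** D + D ** A"
      by (simp only: tproj_alt matrix_algebra DP I PP sw1) (simp add: algebra_simps)
    ultimately show ?thesis by (simp add: D_def)
  qed
  ultimately show ?thesis
    using T by (simp add: matrix_algebra)
qed

section \<open>Horizontal lifts\<close>

lemma herm_scale: "herm (c *s u) w = c * herm u w" "herm u (c *s w) = cnj c * herm u w"
  by (simp_all add: herm_def sum_distrib_left algebra_simps)

lemma cproj_obtain:
  assumes "P \<in> cproj" obtains v where "norm v = 1" "P = hopf v"
  using assms by (auto simp: cproj_def)

lemma matrix_mult_outer: "X ** outer v w = outer (X *v v) w"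
  by (simp add: outer_def matrix_matrix_mult_def matrix_vector_mult_def vec_eq_iff sum_distrib_right mult.assoc)

text \<open>
  Over the unit vector \<open>v\<close> a tangent vector \<open>X\<close> has the horizontal lift \<open>u = X *v v\<close>. Metric and complex
  structure become the standard ones of the complex vector space of lifts, which makes the pointwise
  facts below elementary.
\<close>

lemma tangent_hopf:
  assumes v: "norm v = 1"
  shows "X \<in> tangent_cproj (hopf v) \<longleftrightarrow> (\<exists>u. herm u v = 0 \<and> X = outer u v + outer v u)"
proof
  assume X: "X \<in> tangent_cproj (hopf v)"
  have P: "hopf v \<in> cproj" using v by (auto simp: cproj_def)
  define u where "u = X *v v"
  have c: "ctransp X = X" and s: "hopf v ** X + X ** hopf v = X"
    using X by (auto simp: tangent_cproj_def)
  have XP: "X ** hopf v = outer u v"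
    by (simp add: u_def hopf_def matrix_mult_outer)
  have PX: "hopf v ** X = outer v u"
    using arg_cong [OF XP, of ctransp] by (simp add: ctransp_mult c ctransp_outer cproj_idem [OF P])
  have "outer (herm u v *s v) v = 0"
    using tangent_corner_zero [OF P X] XP by (simp add: hopf_def outer_mult flip: matrix_mul_assoc)
  then have "outer (herm u v *s v) v ** outer v v = 0" by (simp add: matrix_zero)
  then have "herm (herm u v *s v) v * herm v v = 0"
    using \<open>outer (herm u v *s v) v = 0\<close> inner_outer[of "herm u v *s v" v "herm u v *s v" v] v 
    by (auto simp add: herm_scale herm_self complex_mult_cnj complex_eq_iff)
  then have "herm u v = 0" by (simp add: herm_scale herm_self v)
  then show "\<exists>u. herm u v = 0 \<and> X = outer u v + outer v u"
    using XP PX s by (auto simp: add.commute)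
next
  assume "\<exists>u. herm u v = 0 \<and> X = outer u v + outer v u"
  then obtain u where u: "herm u v = 0" "X = outer u v + outer v u" by blast
  have [simp]: "outer (0 *s v) u = 0" "outer 0 u = 0" for u v :: "complex^'a" by (simp_all add: outer_def vec_eq_iff)
  have "herm v u = 0" using u(1) herm_commute by (metis complex_cnj_zero)
  then show "X \<in> tangent_cproj (hopf v)"
    using u v by (simp add: tangent_cproj_def hopf_def ctransp_add ctransp_outer matrix_distribs outer_mult herm_self
        del: vector_scalar_mult_def)
qed

lemma tangent_obtain:
  assumes "norm v = 1" "X \<in> tangent_cproj (hopf v)"
  obtains u where "herm u v = 0" "X = outer u v + outer v u"
  using assms tangent_hopf by blast

lemma cplx_str_tangent:
  assumes "P \<in> cproj" "X \<in> tangent_cproj P" shows "cplx_str P X \<in> tangent_cproj P"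
proof -
  obtain v where v: "norm v = 1" "P = hopf v" using assms(1) by (rule cproj_obtain)
  obtain u where u: "herm u v = 0" "X = outer u v + outer v u" using assms(2) v tangent_obtain by metis
  have "herm (\<i> *s u) v = 0" using u by (simp add: herm_scale)
  then show ?thesis using v u by (auto simp: tangent_hopf cplx_str_hopf)
qed

lemma tangent_scaleR: "X \<in> tangent_cproj P \<Longrightarrow> r *\<^sub>R X \<in> tangent_cproj P"
  by (auto simp: tangent_cproj_def matrix_algebra ctransp_def vec_eq_iff simp flip: scaleR_add_right)

lemma inner_i: "u \<bullet> (\<i> *s w) = - ((\<i> *s u) \<bullet> w)" "(\<i> *s u) \<bullet> (\<i> *s w) = u \<bullet> w"
  for u w :: "complex^'n"
  by (simp_all flip: Re_herm add: herm_scale)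

lemma cplx_str_isometry:
  assumes "P \<in> cproj" "X \<in> tangent_cproj P" "Y \<in> tangent_cproj P"
  shows "fs_metric (cplx_str P X) (cplx_str P Y) = fs_metric X Y"
  using assms by (elim cproj_obtain) (auto simp: tangent_hopf cplx_str_hopf herm_scale fs_metric_hopf inner_i)

lemma cplx_str_antisym:
  assumes "P \<in> cproj" "X \<in> tangent_cproj P" "Y \<in> tangent_cproj P"
  shows "fs_metric X (cplx_str P Y) = - fs_metric Y (cplx_str P X)"
proof -
  obtain v where v: "norm v = 1" "P = hopf v" using assms(1) by (rule cproj_obtain)
  obtain u where u: "herm u v = 0" "X = outer u v + outer v u" using assms(2) v tangent_obtain by metis
  obtain w where w: "herm w v = 0" "Y = outer w v + outer v w" using assms(3) v tangent_obtain by metis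
  have "u \<bullet> (\<i> *s w) = - (w \<bullet> (\<i> *s u))"
    using inner_i(1) [of u w] by (simp add: inner_commute)
  then show ?thesis
    using v u w by (simp add: cplx_str_hopf fs_metric_hopf herm_scale)
qed

text \<open>
  If \<open>u\<close> and \<open>w\<close> lift \<open>X\<close> and \<open>Y\<close>, orthogonality says that \<open>herm u w\<close> is purely imaginary. Its imaginary
  part is the torsion \<open>\<langle>X, JY\<rangle>\<close>, and it is what the double commutator sees besides the lengths.
\<close>

lemma curv_orthonormal:
  assumes P: "P \<in> cproj" and T: "X \<in> tangent_cproj P" "Y \<in> tangent_cproj P"
    and on: "fs_metric X X = 1" "fs_metric X Y = 0"
  shows "curv P X Y X = - Y + (3 * fs_metric X (cplx_str P Y)) *\<^sub>R cplx_str P X"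
proof -
  obtain v where v: "norm v = 1" "P = hopf v" using P by (rule cproj_obtain)
  obtain u where u: "herm u v = 0" "X = outer u v + outer v u" using T(1) v tangent_obtain by metis
  obtain w where w: "herm w v = 0" "Y = outer w v + outer v w" using T(2) v tangent_obtain by metis
  define m where "m = Im (herm u w)"
  have uu: "herm u u = 1"
    using on(1) v u by (simp add: fs_metric_hopf herm_self flip: power2_norm_eq_inner)
  have re: "Re (herm u w) = 0"
    using on(2) v u w by (simp add: fs_metric_hopf Re_herm)
  have uw: "herm u w = \<i> * m" "herm w u = - \<i> * m"
    using re by (simp_all add: herm_commute [of u w] complex_eq_iff m_def)
  have 0: "herm v u = 0" "herm v w = 0" using u w herm_commute by (metis complex_cnj_zero)+
  have t: "fs_metric X (cplx_str P Y) = m"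
    using v u w by (simp add: cplx_str_hopf fs_metric_hopf herm_scale uw flip: Re_herm)
  have J: "cplx_str P X = outer (\<i> *s u) v + outer v (\<i> *s u)"
    using v u by (simp add: cplx_str_hopf)
  have vv: "herm v v = 1" using v by (simp add: herm_self)
  show ?thesis
    unfolding curv_eq_commutator [OF P T(1) T(2) T(1)] t J unfolding u(2) w(2)
    by (simp only: matrix_distribs outer_mult u(1) w(1) uw uu 0 vv herm_scale)
      (simp add: outer_def vec_eq_iff complex_eq_iff algebra_simps)
qed

lemma orthonormal_parseval:
  fixes b :: "'i \<Rightarrow> 'a::euclidean_space"
  assumes fin: "finite I" and card: "card I = DIM('a)"
    and on: "\<And>i j. i \<in> I \<Longrightarrow> j \<in> I \<Longrightarrow> b i \<bullet> b j = (if i = j then 1 else 0)"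
  shows "x \<bullet> y = (\<Sum>i\<in>I. (b i \<bullet> x) * (b i \<bullet> y))"
proof -
  have inj: "inj_on b I"
    using on by (intro inj_onI) (metis zero_neq_one)
  have po: "pairwise orthogonal (b ` I)"
    using on by (auto simp: pairwise_def orthogonal_def)
  have "independent (b ` I)"
    using po on by (intro pairwise_orthogonal_independent) (auto, metis inner_zero_left zero_neq_one)
  moreover have "card (b ` I) = DIM('a)" using card inj by (simp add: card_image)
  ultimately have sp: "span (b ` I) = UNIV"
    using fin card_eq_dim [of "b ` I" UNIV] by (simp add: dim_UNIV) (metis top.extremum_uniqueI)
  have "(\<Sum>e\<in>b ` I. (x \<bullet> e) *\<^sub>R e) = x"
    using fin po sp on by (intro orthonormal_basis_expand) (auto simp: norm_eq_1)
  then have x: "x = (\<Sum>i\<in>I. (x \<bullet> b i) *\<^sub>R b i)"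
    by (simp add: sum.reindex [OF inj])
  show ?thesis
    by (subst x) (simp add: inner_sum_left inner_sum_right inner_commute)
qed

text \<open>
  Four orthonormal tangent vectors form a basis: their lifts, together with \<open>v\<close> and \<open>\<i> v\<close>, are an
  orthonormal family of six vectors in a space of real dimension 6.
\<close>

lemma tangent_parseval:
  fixes P :: "complex^3^3"
  assumes P: "P \<in> cproj" and T: "\<And>i. i \<in> {1..4} \<Longrightarrow> X i \<in> tangent_cproj P"
    and on: "\<And>i j. i \<in> {1..4::nat} \<Longrightarrow> j \<in> {1..4} \<Longrightarrow> fs_metric (X i) (X j) = (if i = j then 1 else 0)"
    and YZ: "Y \<in> tangent_cproj P" "Z \<in> tangent_cproj P"
  shows "fs_metric Y Z = (\<Sum>i\<in>{1..4}. fs_metric (X i) Y * fs_metric (X i) Z)"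
proof -
  obtain v where v: "norm v = 1" "P = hopf v" using P by (rule cproj_obtain)
  obtain y where y: "herm y v = 0" "Y = outer y v + outer v y" using YZ(1) v tangent_obtain by metis
  obtain z where z: "herm z v = 0" "Z = outer z v + outer v z" using YZ(2) v tangent_obtain by metis
  have "\<forall>i\<in>{1..4}. \<exists>u. herm u v = 0 \<and> X i = outer u v + outer v u"
    using T v tangent_hopf by metis
  then obtain u where u: "\<And>i. i \<in> {1..4} \<Longrightarrow> herm (u i) v = 0"
      "\<And>i. i \<in> {1..4} \<Longrightarrow> X i = outer (u i) v + outer v (u i)"
    by metis
  \<comment> \<open>the four horizontal lifts together with the two vertical directions \<open>v\<close> and \<open>\<i>v\<close>\<close>
  define b where "b i = (if i = 0 then v else if i = 5 then \<i> *s v else u i)" for i :: nat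
  have perp: "x \<bullet> v = 0" "x \<bullet> (\<i> *s v) = 0" "v \<bullet> x = 0" "(\<i> *s v) \<bullet> x = 0" if "herm x v = 0" for x
  proof -
    show "x \<bullet> v = 0" "x \<bullet> (\<i> *s v) = 0"
      using that by (simp_all flip: Re_herm add: herm_scale)
    then show "v \<bullet> x = 0" "(\<i> *s v) \<bullet> x = 0" by (simp_all add: inner_commute)
  qed
  have vv: "v \<bullet> v = 1" "v \<bullet> (\<i> *s v) = 0" "(\<i> *s v) \<bullet> v = 0"
    using v(1) by (simp_all flip: Re_herm add: herm_scale herm_self)
  have uu: "u i \<bullet> u j = (if i = j then 1 else 0)" if "i \<in> {1..4}" "j \<in> {1..4}" for i j
    using on [OF that] fs_metric_hopf [OF v(1) u(1) u(1), OF that] u(2) that by simp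
  have I: "{..<6::nat} = insert 0 (insert 5 {1..4})" by auto
  have "b i \<bullet> b j = (if i = j then 1 else 0)" if "i \<in> {..<6}" "j \<in> {..<6}" for i j
    using that unfolding I by (auto simp: b_def perp u vv uu inner_i(2))
  then have "y \<bullet> z = (\<Sum>i\<in>{..<6}. (b i \<bullet> y) * (b i \<bullet> z))"
    by (intro orthonormal_parseval) simp_all
  also have "\<dots> = (\<Sum>i\<in>{1..4}. (b i \<bullet> y) * (b i \<bullet> z))"
    unfolding I using perp y(1) z(1) by (simp add: b_def)
  also have "\<dots> = (\<Sum>i\<in>{1..4}. (u i \<bullet> y) * (u i \<bullet> z))"
    by (intro sum.cong) (auto simp: b_def)
  finally show ?thesis
    using y z u fs_metric_hopf [OF v(1)] by simp
qed

section \<open>Calculus along Frenet curves\<close>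

lemma tproj_scaleR: "tproj P (r *\<^sub>R A) = r *\<^sub>R tproj P A"
  by (simp only: tproj_def matrix_algebra scaleR_add_right scaleR_diff_right)

lemma fs_metric_linear:
  "fs_metric (X + Y) Z = fs_metric X Z + fs_metric Y Z"
  "fs_metric Z (X + Y) = fs_metric Z X + fs_metric Z Y"
  "fs_metric (r *\<^sub>R X) Z = r * fs_metric X Z"
  "fs_metric Z (r *\<^sub>R X) = r * fs_metric Z X"
  "fs_metric (- X) Z = - fs_metric X Z"
  "fs_metric Z (- X) = - fs_metric Z X"
  "fs_metric 0 Z = 0" "fs_metric Z 0 = 0"
  by (simp_all add: fs_metric_def inner_add_left inner_add_right field_simps)

lemma cplx_str_linear:
  "cplx_str P (X + Y) = cplx_str P X + cplx_str P Y"
  "cplx_str P (r *\<^sub>R X) = r *\<^sub>R cplx_str P X"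
  "cplx_str P (- X) = - cplx_str P X"
  "cplx_str P 0 = 0"
  by (simp_all add: cplx_str_def matrix_algebra matrix_zero algebra_simps)

lemma fs_metric_tproj:
  assumes "P \<in> cproj" "X \<in> tangent_cproj P"
  shows "fs_metric (tproj P A) X = fs_metric A X" "fs_metric X (tproj P A) = fs_metric X A"
  using tproj_orthogonal [OF assms, of A] by (simp_all add: fs_metric_def inner_diff_left inner_commute [of X])

lemma nondeg_interval_at_within:
  assumes "nondeg_interval I" "t \<in> I" shows "at t within I \<noteq> bot"
proof -
  have "connected I" using assms by (simp add: nondeg_interval_def is_interval_connected)
  moreover have "\<nexists>x. I = {x}" using assms by (auto simp: nondeg_interval_def)
  ultimately show ?thesis
    using assms connected_imp_perfect [of I t] by (simp add: trivial_limit_within)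
qed

lemma cov_along_eq:
  assumes "nondeg_interval I" "t \<in> I" "(W has_vector_derivative W') (at t within I)"
    and "\<And>s. s \<in> I \<Longrightarrow> V s = W s"
  shows "cov_along I \<gamma> V t = tproj (\<gamma> t) W'"
proof -
  have "(V has_vector_derivative W') (at t within I)"
    using assms by (intro has_vector_derivative_transform [OF assms(2) _ assms(3)]) auto
  then show ?thesis
    using vector_derivative_within [OF nondeg_interval_at_within [OF assms(1,2)], of V W'] by (simp add: cov_along_def)
qed

lemma fs_metric_has_vector_derivative:
  assumes "(V has_vector_derivative V') (at t within I)" "(W has_vector_derivative W') (at t within I)"
  shows "((\<lambda>s. fs_metric (V s) (W s)) has_vector_derivative fs_metric V' (W t) + fs_metric (V t) W') (at t within I)"
proof -
  have "((\<lambda>s. (1/2) *\<^sub>R (V s \<bullet> W s)) has_vector_derivative (1/2) *\<^sub>R (V t \<bullet> W' + V' \<bullet> W t)) (at t within I)"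
    by (intro bounded_linear.has_vector_derivative [OF bounded_linear_scaleR_right]
        bounded_bilinear.has_vector_derivative [OF bounded_bilinear_inner] assms)
  then show ?thesis by (simp add: fs_metric_def field_simps)
qed

lemma scalar_matrix_commute: "M ** mat c = mat c ** M" for M :: "complex^'n^'n"
  by (simp add: matrix_matrix_mult_def mat_def vec_eq_iff if_distrib [of "\<lambda>x. x * _"]
      if_distrib [of "\<lambda>x. _ * x"] cong: if_cong)

lemma tproj_mat: "tproj P (mat c ** M) = mat c ** tproj P M"
proof -
  have "L ** N ** mat c = L ** mat c ** N" for L N :: "complex^'a^'a"
    by (simp add: scalar_matrix_commute flip: matrix_mul_assoc)
  then show ?thesis
    by (simp only: tproj_alt matrix_algebra scalar_matrix_commute)
qed

text \<open>
  The Kaehler property. Differentiating the factors \<open>\<gamma>\<close> in the definition of \<open>cplx_str\<close> produces products of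
  two tangent vectors. These are block diagonal, so the projection annihilates them.
\<close>

lemma cplx_str_parallel:
  fixes \<gamma> :: "real \<Rightarrow> complex^'n^'n"
  assumes "(\<gamma> has_vector_derivative \<gamma>') (at t within I)" "(V has_vector_derivative V') (at t within I)"
    and P: "\<gamma> t \<in> cproj" and T: "V t \<in> tangent_cproj (\<gamma> t)" "\<gamma>' \<in> tangent_cproj (\<gamma> t)"
  obtains W where "((\<lambda>s. cplx_str (\<gamma> s) (V s)) has_vector_derivative W) (at t within I)"
    "tproj (\<gamma> t) W = cplx_str (\<gamma> t) (tproj (\<gamma> t) V')"
proof
  let ?P = "\<gamma> t"
  show "((\<lambda>s. cplx_str (\<gamma> s) (V s)) has_vector_derivative
      mat \<i> ** ((V t ** \<gamma>' + V' ** ?P) - (?P ** V' + \<gamma>' ** V t))) (at t within I)"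
    unfolding cplx_str_def
    by (intro bounded_linear.has_vector_derivative [OF bounded_bilinear.bounded_linear_right [OF bounded_bilinear_matrix_mult]]
        has_vector_derivative_diff matrix_mult_has_vector_derivative assms)
  note I = cproj_idem(2) [OF P]
  note sw = tangent_cproj_swap [OF T(1)] tangent_cproj_swap [OF T(2)]
  have "tproj ?P ((V t ** \<gamma>' + V' ** ?P) - (?P ** V' + \<gamma>' ** V t))
      = tproj ?P V' ** ?P - ?P ** tproj ?P V'"
    by (simp only: tproj_alt matrix_algebra I cproj_idem_right [OF P] sw)
      (simp add: algebra_simps)
  then show "tproj ?P (mat \<i> ** ((V t ** \<gamma>' + V' ** ?P) - (?P ** V' + \<gamma>' ** V t)))
      = cplx_str ?P (tproj ?P V')"
    by (simp add: tproj_mat cplx_str_def)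
qed

lemma frenet_curve_field:
  assumes "frenet_curve I \<gamma> d E k" "i \<in> {1..d}" "t \<in> I"
  shows "E i t \<in> tangent_cproj (\<gamma> t)"
    and "(E i has_vector_derivative vector_derivative (E i) (at t within I)) (at t within I)"
proof -
  have f: "field_along I \<gamma> (E i)" and "nondeg_interval I"
    using assms by (auto simp: frenet_curve_def curve_in_cproj_def)
  then show "E i t \<in> tangent_cproj (\<gamma> t)" using assms by (simp add: field_along_def)
  obtain F where F: "\<forall>t\<in>I. F 0 t = E i t" "\<forall>k. \<forall>t\<in>I. (F k has_vector_derivative F (Suc k) t) (at t within I)"
    using f by (auto simp: field_along_def smooth_curve_def)
  have "(E i has_vector_derivative F 1 t) (at t within I)"
    using F assms(3) by (intro has_vector_derivative_transform [of t I "E i" "F 0"]) auto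
  then show "(E i has_vector_derivative vector_derivative (E i) (at t within I)) (at t within I)"
    using vector_derivative_works differentiableI_vector by blast
qed

lemma frenet_curve_base:
  assumes "frenet_curve I \<gamma> d E k" "t \<in> I"
  shows "\<gamma> t \<in> cproj" "nondeg_interval I"
    and "(\<gamma> has_vector_derivative E 1 t) (at t within I)"
proof -
  have c: "curve_in_cproj I \<gamma>" and v: "E 1 t = velocity I \<gamma> t"
    using assms by (auto simp: frenet_curve_def)
  then show "\<gamma> t \<in> cproj" "nondeg_interval I" using assms(2) by (auto simp: curve_in_cproj_def)
  obtain F where F: "\<forall>t\<in>I. F 0 t = \<gamma> t" "\<forall>k. \<forall>t\<in>I. (F k has_vector_derivative F (Suc k) t) (at t within I)"
    using c by (auto simp: curve_in_cproj_def smooth_curve_def)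
  have "(\<gamma> has_vector_derivative F 1 t) (at t within I)"
    using F assms(2) by (intro has_vector_derivative_transform [of t I "\<gamma>" "F 0"]) auto
  then show "(\<gamma> has_vector_derivative E 1 t) (at t within I)"
    unfolding v velocity_def using vector_derivative_works differentiableI_vector by blast
qed

lemma ctorsion_has_real_derivative:
  assumes fr: "frenet_curve I \<gamma> d E k" and ij: "i \<in> {1..d}" "j \<in> {1..d}" and t: "t \<in> I"
  shows "(ctorsion \<gamma> E i j has_real_derivative
      fs_metric (cov_along I \<gamma> (E i) t) (cplx_str (\<gamma> t) (E j t))
      + fs_metric (E i t) (cplx_str (\<gamma> t) (cov_along I \<gamma> (E j) t))) (at t within I)"
proof -
  note b = frenet_curve_base [OF fr t]
  note i = frenet_curve_field [OF fr ij(1) t]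
  note j = frenet_curve_field [OF fr ij(2) t]
  have "1 \<in> {1..d}" using fr by (simp add: frenet_curve_def)
  note one = frenet_curve_field (1) [OF fr this t]
  obtain W where W: "((\<lambda>s. cplx_str (\<gamma> s) (E j s)) has_vector_derivative W) (at t within I)"
    "tproj (\<gamma> t) W = cplx_str (\<gamma> t) (tproj (\<gamma> t) (vector_derivative (E j) (at t within I)))"
    using cplx_str_parallel [OF b(3) j(2) b(1) j(1) one] .
  have "(ctorsion \<gamma> E i j has_vector_derivative
      fs_metric (vector_derivative (E i) (at t within I)) (cplx_str (\<gamma> t) (E j t)) + fs_metric (E i t) W) (at t within I)"
    unfolding ctorsion_def [abs_def] by (rule fs_metric_has_vector_derivative [OF i(2) W(1)])
  then show ?thesis
    using fs_metric_tproj(1) [OF b(1) cplx_str_tangent [OF b(1) j(1)]] fs_metric_tproj(2) [OF b(1) i(1), of W] W(2)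
    by (simp add: cov_along_def has_real_derivative_iff_has_vector_derivative)
qed

text \<open>
  Differentiability of the curvatures is not part of the definition of a Frenet curve. It is inherited
  from the frame, because \<open>k\<^sub>i = \<langle>\<nabla>E\<^sub>i, E\<^sub>i\<^sub>+\<^sub>1\<rangle>\<close> and only the ambient derivative of \<open>E\<^sub>i\<close> matters here.
\<close>

lemma frenet_curvature_smooth:
  assumes fr: "frenet_curve I \<gamma> d E k" and i: "i \<in> {1..<d}"
  obtains k' k'' where "\<And>t. t \<in> I \<Longrightarrow> (k i has_real_derivative k' t) (at t within I)"
    "\<And>t. t \<in> I \<Longrightarrow> (k' has_real_derivative k'' t) (at t within I)"
proof -
  have d: "i \<in> {1..d}" "Suc i \<in> {1..d}" using i by auto
  have "smooth_curve I (E i)" "smooth_curve I (E (Suc i))"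
    using fr d by (auto simp: frenet_curve_def field_along_def)
  then obtain F G where F: "\<And>t. t \<in> I \<Longrightarrow> F 0 t = E i t"
      "\<And>n t. t \<in> I \<Longrightarrow> (F n has_vector_derivative F (Suc n) t) (at t within I)"
    and G: "\<And>t. t \<in> I \<Longrightarrow> G 0 t = E (Suc i) t"
      "\<And>n t. t \<in> I \<Longrightarrow> (G n has_vector_derivative G (Suc n) t) (at t within I)"
    unfolding smooth_curve_def by metis
  define h where "h m n t = fs_metric (F m t) (G n t)" for m n t
  have h: "(h m n has_real_derivative h (Suc m) n t + h m (Suc n) t) (at t within I)" if "t \<in> I" for m n t
    using fs_metric_has_vector_derivative [OF F(2) G(2), OF that that]
    by (simp add: h_def [abs_def] has_real_derivative_iff_has_vector_derivative)
  have k: "k i t = h 1 0 t" if t: "t \<in> I" for t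
  proof -
    note b = frenet_curve_base [OF fr t]
    have on: "fs_metric (E a t) (E b t) = (if a = b then 1 else 0)" if "a \<in> {1..d}" "b \<in> {1..d}" for a b
      using fr that t by (simp add: frenet_curve_def)
    have "fs_metric (cov_along I \<gamma> (E i) t) (E (Suc i) t) = k i t"
    proof -
      have "cov_along I \<gamma> (E i) t =
        (if i = 1 then 0 else - (k (i - 1) t *\<^sub>R E (i - 1) t)) + k i t *\<^sub>R E (i + 1) t"
        using fr d t i by (simp add: frenet_curve_def)
      moreover have "i - 1 \<in> {1..d}" if "i \<noteq> 1" using i that by auto
      ultimately show ?thesis using d by (auto simp: fs_metric_linear on)
    qed
    moreover have "cov_along I \<gamma> (E i) t = tproj (\<gamma> t) (F 1 t)"
      using F(1) F(2) [OF t, of 0] by (intro cov_along_eq [OF b(2) t, where W = "F 0"]) auto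
    ultimately show ?thesis
      using fs_metric_tproj(1) [OF b(1) frenet_curve_field(1) [OF fr d(2) t]] G t by (simp add: h_def)
  qed
  show ?thesis
  proof
    show "(k i has_real_derivative h 2 0 t + h 1 1 t) (at t within I)" if "t \<in> I" for t
      using has_field_derivative_transform_within [OF h [OF that, of 1 0] zero_less_one that] k
      by (simp add: numeral_2_eq_2)
    show "((\<lambda>t. h 2 0 t + h 1 1 t) has_real_derivative (h 3 0 t + h 2 1 t) + (h 2 1 t + h 1 2 t)) (at t within I)" if "t \<in> I" for t
      using DERIV_add [OF h [OF that, of 2 0] h [OF that, of 1 1]] by (simp add: numeral_2_eq_2 numeral_3_eq_3)
  qed
qed

text \<open>
  The Leibniz rule, in a form that keeps the ambient derivative \<open>W\<close> available, so that several such
  terms can be added up before projecting.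
\<close>

lemma cov_along_scaleR_frenet:
  assumes fr: "frenet_curve I \<gamma> d E k" and i: "i \<in> {1..d}" and t: "t \<in> I"
    and f: "(f has_real_derivative f') (at t within I)"
  obtains W where "((\<lambda>s. f s *\<^sub>R E i s) has_vector_derivative W) (at t within I)"
    "tproj (\<gamma> t) W = f' *\<^sub>R E i t + f t *\<^sub>R cov_along I \<gamma> (E i) t"
proof
  note b = frenet_curve_base [OF fr t]
  note e = frenet_curve_field [OF fr i t]
  show "((\<lambda>s. f s *\<^sub>R E i s) has_vector_derivative 
      f t *\<^sub>R vector_derivative (E i) (at t within I) + f' *\<^sub>R E i t) (at t within I)"
    by (rule has_vector_derivative_scaleR [OF f e(2)])
  show "tproj (\<gamma> t) (f t *\<^sub>R vector_derivative (E i) (at t within I) + f' *\<^sub>R E i t)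
      = f' *\<^sub>R E i t + f t *\<^sub>R cov_along I \<gamma> (E i) t"
    by (simp add: tproj_add tproj_scaleR tproj_tangent [OF b(1) e(1)] cov_along_def)
qed

lemma frenet_equations_4:
  assumes fr: "frenet_curve I \<gamma> 4 E k" and t: "t \<in> I"
  shows "cov_along I \<gamma> (E 1) t = k 1 t *\<^sub>R E 2 t"
    "cov_along I \<gamma> (E 2) t = - (k 1 t *\<^sub>R E 1 t) + k 2 t *\<^sub>R E 3 t"
    "cov_along I \<gamma> (E 3) t = - (k 2 t *\<^sub>R E 2 t) + k 3 t *\<^sub>R E 4 t"
    "cov_along I \<gamma> (E 4) t = - (k 3 t *\<^sub>R E 3 t)"
proof -
  have "\<forall>i\<in>{1..4}. cov_along I \<gamma> (E i) t =
      (if i = 1 then 0 else - (k (i - 1) t *\<^sub>R E (i - 1) t)) +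
      (if i = 4 then 0 else k i t *\<^sub>R E (i + 1) t)"
    using fr t by (simp add: frenet_curve_def)
  from this [THEN bspec, of 1] this [THEN bspec, of 2] this [THEN bspec, of 3] this [THEN bspec, of 4]
  show "cov_along I \<gamma> (E 1) t = k 1 t *\<^sub>R E 2 t"
    "cov_along I \<gamma> (E 2) t = - (k 1 t *\<^sub>R E 1 t) + k 2 t *\<^sub>R E 3 t"
    "cov_along I \<gamma> (E 3) t = - (k 2 t *\<^sub>R E 2 t) + k 3 t *\<^sub>R E 4 t"
    "cov_along I \<gamma> (E 4) t = - (k 3 t *\<^sub>R E 3 t)"
    by (simp_all add: eval_nat_numeral)
qed

text \<open>
  Three applications of the Frenet equations to \<open>E\<^sub>1\<close> give the derivative part; the curvature term adds
  \<open>k\<^sub>1 E\<^sub>2\<close> and the multiple of \<open>J E\<^sub>1\<close>. The latter is not expanded in the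
  frame: its components are unknown for a given curve, and known for a constructed one.
\<close>

lemma bitension_frenet:
  fixes \<gamma> :: "real \<Rightarrow> complex^3^3"
  assumes fr: "frenet_curve I \<gamma> 4 E k"
    and k1: "\<And>t. t \<in> I \<Longrightarrow> (k 1 has_real_derivative k1' t) (at t within I)"
    and k1': "\<And>t. t \<in> I \<Longrightarrow> (k1' has_real_derivative k1'' t) (at t within I)"
    and k2: "\<And>t. t \<in> I \<Longrightarrow> (k 2 has_real_derivative k2' t) (at t within I)"
    and t: "t \<in> I"
  shows "tension I \<gamma> t = k 1 t *\<^sub>R E 2 t"
    and "bitension I \<gamma> t =
      (- 3 * k 1 t * k1' t) *\<^sub>R E 1 t + (k1'' t - k 1 t * ((k 1 t)\<^sup>2 + (k 2 t)\<^sup>2 - 1)) *\<^sub>R E 2 t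
      + (2 * k1' t * k 2 t + k 1 t * k2' t) *\<^sub>R E 3 t + (k 1 t * k 2 t * k 3 t) *\<^sub>R E 4 t
      - (3 * k 1 t * ctorsion \<gamma> E 1 2 t) *\<^sub>R cplx_str (\<gamma> t) (E 1 t)"
proof -
  note D = frenet_equations_4 [OF fr]
  have T: "tension I \<gamma> t = k 1 t *\<^sub>R E 2 t" if t: "t \<in> I" for t
  proof -
    have "tension I \<gamma> t = cov_along I \<gamma> (E 1) t"
      using fr unfolding tension_def cov_along_def[of I \<gamma> "E 1"]
      by (intro cov_along_eq [OF frenet_curve_base(2) [OF fr t] t, where W = "E 1"] frenet_curve_field(2) [OF fr _ t])
        (auto simp: frenet_curve_def)
    then show ?thesis using D t by simp
  qed
  then show "tension I \<gamma> t = k 1 t *\<^sub>R E 2 t" using t .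
  have T2: "cov_along I \<gamma> (tension I \<gamma>) t =
      (- (k 1 t)\<^sup>2) *\<^sub>R E 1 t + k1' t *\<^sub>R E 2 t + (k 1 t * k 2 t) *\<^sub>R E 3 t" if t: "t \<in> I" for t
  proof -
    obtain W where W: "((\<lambda>s. k 1 s *\<^sub>R E 2 s) has_vector_derivative W) (at t within I)"
      "tproj (\<gamma> t) W = k1' t *\<^sub>R E 2 t + k 1 t *\<^sub>R cov_along I \<gamma> (E 2) t"
      using cov_along_scaleR_frenet [OF fr _ t k1 [OF t], of 2] by auto
    have "cov_along I \<gamma> (tension I \<gamma>) t = tproj (\<gamma> t) W"
      by (rule cov_along_eq [OF frenet_curve_base(2) [OF fr t] t W(1) T])
    then show ?thesis
      unfolding W(2) D [OF t] by (simp add: algebra_simps power2_eq_square)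
  qed
  have T3: "cov_along I \<gamma> (cov_along I \<gamma> (tension I \<gamma>)) t =
      (- 3 * k 1 t * k1' t) *\<^sub>R E 1 t + (k1'' t - k 1 t * ((k 1 t)\<^sup>2 + (k 2 t)\<^sup>2)) *\<^sub>R E 2 t
      + (2 * k1' t * k 2 t + k 1 t * k2' t) *\<^sub>R E 3 t + (k 1 t * k 2 t * k 3 t) *\<^sub>R E 4 t"
  proof -
    have a: "((\<lambda>s. - (k 1 s)\<^sup>2) has_real_derivative - (2 * k 1 t * k1' t)) (at t within I)"
      by (rule derivative_eq_intros k1 t refl | simp)+
    have c: "((\<lambda>s. k 1 s * k 2 s) has_real_derivative k1' t * k 2 t + k2' t * k 1 t) (at t within I)"
      by (rule DERIV_mult k1 k2 t)+
    obtain W1 where W1: "((\<lambda>s. (- (k 1 s)\<^sup>2) *\<^sub>R E 1 s) has_vector_derivative W1) (at t within I)"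
      "tproj (\<gamma> t) W1 = (- (2 * k 1 t * k1' t)) *\<^sub>R E 1 t + (- (k 1 t)\<^sup>2) *\<^sub>R cov_along I \<gamma> (E 1) t"
      using cov_along_scaleR_frenet [OF fr _ t a, of 1] by auto
    obtain W2 where W2: "((\<lambda>s. k1' s *\<^sub>R E 2 s) has_vector_derivative W2) (at t within I)"
      "tproj (\<gamma> t) W2 = k1'' t *\<^sub>R E 2 t + k1' t *\<^sub>R cov_along I \<gamma> (E 2) t"
      using cov_along_scaleR_frenet [OF fr _ t k1' [OF t], of 2] by auto
    obtain W3 where W3: "((\<lambda>s. (k 1 s * k 2 s) *\<^sub>R E 3 s) has_vector_derivative W3) (at t within I)"
      "tproj (\<gamma> t) W3 = (k1' t * k 2 t + k2' t * k 1 t) *\<^sub>R E 3 t + (k 1 t * k 2 t) *\<^sub>R cov_along I \<gamma> (E 3) t"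
      using cov_along_scaleR_frenet [OF fr _ t c, of 3] by auto
    have "cov_along I \<gamma> (cov_along I \<gamma> (tension I \<gamma>)) t = tproj (\<gamma> t) (W1 + W2 + W3)"
      by (rule cov_along_eq [OF frenet_curve_base(2) [OF fr t] t
          has_vector_derivative_add [OF has_vector_derivative_add [OF W1(1) W2(1)] W3(1)] T2])
    also have "\<dots> = (- 3 * k 1 t * k1' t) *\<^sub>R E 1 t + (k1'' t - k 1 t * ((k 1 t)\<^sup>2 + (k 2 t)\<^sup>2)) *\<^sub>R E 2 t
      + (2 * k1' t * k 2 t + k 1 t * k2' t) *\<^sub>R E 3 t + (k 1 t * k 2 t * k 3 t) *\<^sub>R E 4 t"
      unfolding tproj_add W1(2) W2(2) W3(2) D [OF t]
      by (simp add: vec_eq_iff scaleR_conv_of_real algebra_simps power2_eq_square)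
    finally show ?thesis .
  qed
  have P: "\<gamma> t \<in> cproj" using frenet_curve_base [OF fr t] by simp
  have tan: "E i t \<in> tangent_cproj (\<gamma> t)" if "i \<in> {1..4}" for i
    using frenet_curve_field(1) [OF fr that t] .
  have v: "velocity I \<gamma> t = E 1 t" using fr t by (simp add: frenet_curve_def)
  have C: "curv (\<gamma> t) (E 1 t) (k 1 t *\<^sub>R E 2 t) (E 1 t) = k 1 t *\<^sub>R curv (\<gamma> t) (E 1 t) (E 2 t) (E 1 t)"
    using tan by (simp add: curv_eq_commutator P tangent_scaleR matrix_algebra algebra_simps)
  have on: "\<forall>i\<in>{1..4}. \<forall>j\<in>{1..4}. fs_metric (E i t) (E j t) = (if i = j then 1 else 0)"
    using fr t by (simp add: frenet_curve_def)
  have R: "curv (\<gamma> t) (E 1 t) (E 2 t) (E 1 t) =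
      - E 2 t + (3 * ctorsion \<gamma> E 1 2 t) *\<^sub>R cplx_str (\<gamma> t) (E 1 t)"
    unfolding ctorsion_def
    using on [THEN bspec, of 1, THEN bspec, of 1] on [THEN bspec, of 1, THEN bspec, of 2]
    by (intro curv_orthonormal P tan) simp_all
  show "bitension I \<gamma> t =
      (- 3 * k 1 t * k1' t) *\<^sub>R E 1 t + (k1'' t - k 1 t * ((k 1 t)\<^sup>2 + (k 2 t)\<^sup>2 - 1)) *\<^sub>R E 2 t
      + (2 * k1' t * k 2 t + k 1 t * k2' t) *\<^sub>R E 3 t + (k 1 t * k 2 t * k 3 t) *\<^sub>R E 4 t
      - (3 * k 1 t * ctorsion \<gamma> E 1 2 t) *\<^sub>R cplx_str (\<gamma> t) (E 1 t)"
    unfolding bitension_def rough_laplacian_def T3 v T [OF t] C R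
    by (simp add: vec_eq_iff scaleR_conv_of_real algebra_simps)
qed

section \<open>Biharmonic curves of order 4 are helices\<close>

lemma constant_derivative_zero:
  assumes "nondeg_interval I" "t \<in> I" "(f has_real_derivative d) (at t within I)"
    and "\<And>s. s \<in> I \<Longrightarrow> f s = c"
  shows "d = 0"
proof -
  have "(f has_vector_derivative 0) (at t within I)"
    using assms(2,4) by (intro has_vector_derivative_transform [OF assms(2) _ has_vector_derivative_const]) auto
  then show ?thesis
    using vector_derivative_unique_within [OF nondeg_interval_at_within [OF assms(1,2)]] assms(3)
    by (auto simp: has_real_derivative_iff_has_vector_derivative)
qed

lemma zero_derivative_constant:
  assumes "nondeg_interval I" "\<And>t. t \<in> I \<Longrightarrow> (f has_real_derivative 0) (at t within I)"
  obtains c where "\<And>t. t \<in> I \<Longrightarrow> f t = c"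
  using has_field_derivative_zero_constant [of I f] assms
  by (auto simp: nondeg_interval_def is_interval_convex)

lemma ctorsion_commute:
  assumes fr: "frenet_curve I \<gamma> d E k" and ij: "i \<in> {1..d}" "j \<in> {1..d}" and t: "t \<in> I"
  shows "ctorsion \<gamma> E i j t = - ctorsion \<gamma> E j i t"
  unfolding ctorsion_def
  by (intro cplx_str_antisym frenet_curve_base [OF fr t] frenet_curve_field [OF fr _ t] ij)

lemma ctorsion_orthogonal:
  fixes \<gamma> :: "real \<Rightarrow> complex^3^3"
  assumes fr: "frenet_curve I \<gamma> 4 E k" and ij: "i \<in> {1..4}" "j \<in> {1..4}" and t: "t \<in> I"
  shows "(\<Sum>l\<in>{1..4}. ctorsion \<gamma> E l i t * ctorsion \<gamma> E l j t) = (if i = j then 1 else 0)"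
proof -
  note P = frenet_curve_base(1) [OF fr t]
  have T: "E l t \<in> tangent_cproj (\<gamma> t)" if "l \<in> {1..4}" for l
    using frenet_curve_field(1) [OF fr that t] .
  have on: "fs_metric (E a t) (E b t) = (if a = b then 1 else 0)" if "a \<in> {1..4}" "b \<in> {1..4}" for a b
    using fr that t by (simp add: frenet_curve_def)
  show ?thesis
    using tangent_parseval [OF P, of "\<lambda>l. E l t" "cplx_str (\<gamma> t) (E i t)" "cplx_str (\<gamma> t) (E j t)"]
      cplx_str_isometry [OF P T T, OF ij] on T ij cplx_str_tangent [OF P]
    by (simp add: ctorsion_def)
qed

text \<open>
  The torsions form the matrix of \<open>J\<close> in an orthonormal basis of the tangent space. It is skew, and
  orthogonal because \<open>J\<close> is an isometry; these are the entries of that condition that are used later.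
\<close>

lemma ctorsion_relations:
  fixes \<gamma> :: "real \<Rightarrow> complex^3^3"
  assumes fr: "frenet_curve I \<gamma> 4 E k" and t: "t \<in> I"
  defines "\<tau> \<equiv> \<lambda>i j. ctorsion \<gamma> E i j t"
  shows "(\<tau> 1 2)\<^sup>2 + (\<tau> 1 3)\<^sup>2 + (\<tau> 1 4)\<^sup>2 = 1"
    and "(\<tau> 1 2)\<^sup>2 + (\<tau> 2 3)\<^sup>2 + (\<tau> 2 4)\<^sup>2 = 1"
    and "\<tau> 1 3 * \<tau> 2 3 + \<tau> 1 4 * \<tau> 2 4 = 0"
    and "\<tau> 1 4 * \<tau> 3 4 = \<tau> 1 2 * \<tau> 2 3"
proof -
  have s: "(\<Sum>l\<in>{1..4::nat}. f l) = f 1 + f 2 + f 3 + f 4" for f :: "nat \<Rightarrow> real"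
    by (simp add: eval_nat_numeral)
  have c: "\<tau> i j = - \<tau> j i" if "i \<in> {1..4}" "j \<in> {1..4}" for i j
    unfolding \<tau>_def by (rule ctorsion_commute [OF fr that t])
  have z: "\<tau> i i = 0" if "i \<in> {1..4}" for i using c [OF that that] by simp
  have r: "\<tau> 2 1 = - \<tau> 1 2" "\<tau> 3 1 = - \<tau> 1 3" "\<tau> 4 1 = - \<tau> 1 4" "\<tau> 3 2 = - \<tau> 2 3"
    "\<tau> 4 2 = - \<tau> 2 4" "\<tau> 4 3 = - \<tau> 3 4" "\<tau> 1 1 = 0" "\<tau> 2 2 = 0" "\<tau> 3 3 = 0" "\<tau> 4 4 = 0"
    by (rule c z; simp)+
  have o: "\<tau> 1 i * \<tau> 1 j + \<tau> 2 i * \<tau> 2 j + \<tau> 3 i * \<tau> 3 j + \<tau> 4 i * \<tau> 4 j = (if i = j then 1 else 0)"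
    if "i \<in> {1..4}" "j \<in> {1..4}" for i j
    using ctorsion_orthogonal [OF fr that t] unfolding s \<tau>_def .
  show "(\<tau> 1 2)\<^sup>2 + (\<tau> 1 3)\<^sup>2 + (\<tau> 1 4)\<^sup>2 = 1"
    using o [of 1 1] by (simp add: r power2_eq_square del: One_nat_def)
  show "(\<tau> 1 2)\<^sup>2 + (\<tau> 2 3)\<^sup>2 + (\<tau> 2 4)\<^sup>2 = 1"
    using o [of 2 2] by (simp add: r power2_eq_square del: One_nat_def)
  show "\<tau> 1 3 * \<tau> 2 3 + \<tau> 1 4 * \<tau> 2 4 = 0"
    using o [of 1 2] by (simp add: r del: One_nat_def)
  show "\<tau> 1 4 * \<tau> 3 4 = \<tau> 1 2 * \<tau> 2 3"
    using o [of 1 3] by (simp add: r del: One_nat_def)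
qed

text \<open>
  \<open>J\<close> is parallel, so the torsions are differentiated by the Frenet equations alone.
\<close>

lemma ctorsion_derivatives:
  fixes \<gamma> :: "real \<Rightarrow> complex^'n^'n"
  assumes fr: "frenet_curve I \<gamma> 4 E k" and t: "t \<in> I"
  defines "\<tau> \<equiv> \<lambda>i j. ctorsion \<gamma> E i j t"
  shows "(ctorsion \<gamma> E 1 2 has_real_derivative k 2 t * \<tau> 1 3) (at t within I)"
    and "(ctorsion \<gamma> E 1 3 has_real_derivative k 1 t * \<tau> 2 3 - k 2 t * \<tau> 1 2 + k 3 t * \<tau> 1 4) (at t within I)"
    and "(ctorsion \<gamma> E 1 4 has_real_derivative k 1 t * \<tau> 2 4 - k 3 t * \<tau> 1 3) (at t within I)"
proof -
  note D = frenet_equations_4 [OF fr t]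
  have z: "\<tau> i i = 0" if "i \<in> {1..4}" for i
    using ctorsion_commute [OF fr that that t] by (simp add: \<tau>_def)
  have [simp]: "\<tau> 1 1 = 0" "\<tau> 2 2 = 0" by (rule z; simp)+
  have e: "fs_metric (E i t) (cplx_str (\<gamma> t) (E j t)) = \<tau> i j" for i j
    by (simp add: \<tau>_def ctorsion_def)
  note d = ctorsion_has_real_derivative [OF fr _ _ t]
  show "(ctorsion \<gamma> E 1 2 has_real_derivative k 2 t * \<tau> 1 3) (at t within I)"
    using d [of 1 2] unfolding D fs_metric_linear cplx_str_linear e by (simp del: One_nat_def)
  show "(ctorsion \<gamma> E 1 3 has_real_derivative k 1 t * \<tau> 2 3 - k 2 t * \<tau> 1 2 + k 3 t * \<tau> 1 4) (at t within I)"
    using d [of 1 3] unfolding D fs_metric_linear cplx_str_linear e by (simp add: algebra_simps del: One_nat_def)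
  show "(ctorsion \<gamma> E 1 4 has_real_derivative k 1 t * \<tau> 2 4 - k 3 t * \<tau> 1 3) (at t within I)"
    using d [of 1 4] unfolding D fs_metric_linear cplx_str_linear e by (simp add: algebra_simps del: One_nat_def)
qed

lemma bitension_zero_components:
  fixes \<gamma> :: "real \<Rightarrow> complex^3^3"
  assumes fr: "frenet_curve I \<gamma> 4 E k"
    and k1: "\<And>t. t \<in> I \<Longrightarrow> (k 1 has_real_derivative k1' t) (at t within I)"
    and k1': "\<And>t. t \<in> I \<Longrightarrow> (k1' has_real_derivative k1'' t) (at t within I)"
    and k2: "\<And>t. t \<in> I \<Longrightarrow> (k 2 has_real_derivative k2' t) (at t within I)"
    and t: "t \<in> I" and z: "bitension I \<gamma> t = 0"
  defines "\<tau> \<equiv> \<lambda>i j. ctorsion \<gamma> E i j t"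
  shows "k1' t = 0"
    and "k1'' t = k 1 t * ((k 1 t)\<^sup>2 + (k 2 t)\<^sup>2 - 1 - 3 * (\<tau> 1 2)\<^sup>2)"
    and "2 * k1' t * k 2 t + k 1 t * k2' t = - (3 * k 1 t * \<tau> 1 2 * \<tau> 1 3)"
    and "k 2 t * k 3 t = - 3 * \<tau> 1 2 * \<tau> 1 4"
proof -
  have on: "fs_metric (E i t) (E j t) = (if i = j then 1 else 0)" if "i \<in> {1..4}" "j \<in> {1..4}" for i j
    using fr that t by (simp add: frenet_curve_def)
  have o: "fs_metric (E 1 t) (E 1 t) = 1" "fs_metric (E 2 t) (E 2 t) = 1" "fs_metric (E 3 t) (E 3 t) = 1"
    "fs_metric (E 4 t) (E 4 t) = 1" "fs_metric (E 1 t) (E 2 t) = 0" "fs_metric (E 1 t) (E 3 t) = 0"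
    "fs_metric (E 1 t) (E 4 t) = 0" "fs_metric (E 2 t) (E 1 t) = 0" "fs_metric (E 2 t) (E 3 t) = 0"
    "fs_metric (E 2 t) (E 4 t) = 0" "fs_metric (E 3 t) (E 1 t) = 0" "fs_metric (E 3 t) (E 2 t) = 0"
    "fs_metric (E 3 t) (E 4 t) = 0" "fs_metric (E 4 t) (E 1 t) = 0" "fs_metric (E 4 t) (E 2 t) = 0"
    "fs_metric (E 4 t) (E 3 t) = 0"
    by (subst on; simp)+
  have k: "0 < k 1 t" using fr t by (simp add: frenet_curve_def)
  have J: "fs_metric (E i t) (cplx_str (\<gamma> t) (E 1 t)) = - \<tau> 1 i" if "i \<in> {1..4}" for i
    using ctorsion_commute [OF fr that _ t, of 1] by (simp add: \<tau>_def ctorsion_def)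
  have J1: "\<tau> 1 1 = 0"
    using ctorsion_commute [OF fr _ _ t, of 1 1] by (simp add: \<tau>_def)
  have "(- 3 * k 1 t * k1' t) *\<^sub>R E 1 t + (k1'' t - k 1 t * ((k 1 t)\<^sup>2 + (k 2 t)\<^sup>2 - 1)) *\<^sub>R E 2 t
      + (2 * k1' t * k 2 t + k 1 t * k2' t) *\<^sub>R E 3 t + (k 1 t * k 2 t * k 3 t) *\<^sub>R E 4 t
      + (- (3 * k 1 t * \<tau> 1 2)) *\<^sub>R cplx_str (\<gamma> t) (E 1 t) = 0"
    using bitension_frenet(2) [OF fr, of k1' k1'' k2' t] k1 k1' k2 t z unfolding \<tau>_def by simp
  then have *: "fs_metric (E i t) ((- 3 * k 1 t * k1' t) *\<^sub>R E 1 t + (k1'' t - k 1 t * ((k 1 t)\<^sup>2 + (k 2 t)\<^sup>2 - 1)) *\<^sub>R E 2 t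
      + (2 * k1' t * k 2 t + k 1 t * k2' t) *\<^sub>R E 3 t + (k 1 t * k 2 t * k 3 t) *\<^sub>R E 4 t
      + (- (3 * k 1 t * \<tau> 1 2)) *\<^sub>R cplx_str (\<gamma> t) (E 1 t)) = 0" for i
    by (simp only: fs_metric_linear)
  show "k1' t = 0"
    using * [of 1] k unfolding fs_metric_linear by (simp add: o J J1 del: One_nat_def)
  show "k1'' t = k 1 t * ((k 1 t)\<^sup>2 + (k 2 t)\<^sup>2 - 1 - 3 * (\<tau> 1 2)\<^sup>2)"
    using * [of 2] unfolding fs_metric_linear by (simp add: o J algebra_simps power2_eq_square del: One_nat_def)
  show "2 * k1' t * k 2 t + k 1 t * k2' t = - (3 * k 1 t * \<tau> 1 2 * \<tau> 1 3)"
    using * [of 3] unfolding fs_metric_linear by (simp add: o J del: One_nat_def)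
  have "k 1 t * (k 2 t * k 3 t + 3 * \<tau> 1 2 * \<tau> 1 4) = 0"
    using * [of 4] unfolding fs_metric_linear by (simp add: o J algebra_simps del: One_nat_def)
  then show "k 2 t * k 3 t = - 3 * \<tau> 1 2 * \<tau> 1 4"
    using k by (simp add: eq_neg_iff_add_eq_0)
qed

text \<open>
  A skew orthogonal matrix of size 4 is self-dual or anti-self-dual. With vanishing \<open>\<tau>\<^sub>1\<^sub>3\<close> this
  means \<open>\<tau>\<^sub>2\<^sub>3 = \<plusminus> \<tau>\<^sub>1\<^sub>4\<close> and \<open>\<tau>\<^sub>3\<^sub>4 = \<plusminus> \<tau>\<^sub>1\<^sub>2\<close> with the same sign. Biharmonicity forces \<open>a = \<tau>\<^sub>1\<^sub>2\<close>
  and \<open>c = \<tau>\<^sub>1\<^sub>4\<close> to have opposite signs, and then the plus sign contradicts \<open>\<tau>\<^sub>1\<^sub>3' = 0\<close>.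
\<close>

lemma torsion_matrix_algebra:
  fixes a c p q r :: real
  assumes k: "0 < k1" "0 < k2" "0 < k3" and e: "k2 * k3 = - 3 * a * c"
    and n: "a\<^sup>2 + c\<^sup>2 = 1" "a\<^sup>2 + p\<^sup>2 + q\<^sup>2 = 1" and o: "c * q = 0" "c * r = a * p"
    and d: "k1 * p - k2 * a + k3 * c = 0"
  shows "q = 0" "p = - c" "r = - a" "(k1 - k3) * c = - (k2 * a)" "0 < k1 - k3"
proof -
  have "0 < k2 * k3" using k by simp
  then have ac: "a * c < 0" using e by simp
  then have nz: "a \<noteq> 0" "c \<noteq> 0" by auto
  then show q: "q = 0" using o by simp
  have "p\<^sup>2 = c\<^sup>2" using n q by simp
  moreover have "p \<noteq> c"
  proof
    assume "p = c"
    then have "(k1 + k3) * (a * c) = k2 * a\<^sup>2"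
      using d by (simp add: algebra_simps power2_eq_square)
    moreover have "(k1 + k3) * (a * c) < 0" using k ac by (simp add: mult_pos_neg)
    moreover have "0 < k2 * a\<^sup>2" using k nz by simp
    ultimately show False by simp
  qed
  ultimately show p: "p = - c" by (simp add: power2_eq_iff)
  have "c * (r + a) = 0" using o(2) p by (simp add: algebra_simps)
  then show "r = - a" using nz by (simp add: eq_neg_iff_add_eq_0)
  show dc: "(k1 - k3) * c = - (k2 * a)" using d p by (simp add: algebra_simps)
  have "(k1 - k3) * (- (a * c)) = k2 * a\<^sup>2"
    using arg_cong [OF dc, of "\<lambda>x. - a * x"] by (simp add: algebra_simps power2_eq_square)
  moreover have "0 < k2 * a\<^sup>2" using k nz by simp
  ultimately show "0 < k1 - k3" using ac by (metis neg_0_less_iff_less zero_less_mult_pos2)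
qed

text \<open>
  The unit vector \<open>(a, c)\<close> is orthogonal to \<open>(k2, d)\<close>, which determines it up to sign.
\<close>

lemma torsion_direction:
  fixes a c d :: real
  assumes "0 < d" "0 < k2" "d * c = - (k2 * a)" "a\<^sup>2 + c\<^sup>2 = 1"
  shows "a = sgn a * (d / sqrt (k2\<^sup>2 + d\<^sup>2))" "- c = k2 * a / d"
proof -
  have "a\<^sup>2 * (k2\<^sup>2 + d\<^sup>2) = d\<^sup>2 * (a\<^sup>2 + c\<^sup>2)"
    using arg_cong [OF assms(3), of "\<lambda>x. x\<^sup>2"] by (simp add: power_mult_distrib algebra_simps)
  also have "\<dots> = d\<^sup>2" using assms by simp
  finally have "sqrt (a\<^sup>2 * (k2\<^sup>2 + d\<^sup>2)) = d" using assms(1) by simp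
  then have "\<bar>a\<bar> * sqrt (k2\<^sup>2 + d\<^sup>2) = d" by (simp add: real_sqrt_mult)
  moreover have "sqrt (k2\<^sup>2 + d\<^sup>2) \<noteq> 0" using assms by (simp add: add_nonneg_eq_0_iff)
  ultimately have "\<bar>a\<bar> = d / sqrt (k2\<^sup>2 + d\<^sup>2)" by (simp add: field_simps)
  then show "a = sgn a * (d / sqrt (k2\<^sup>2 + d\<^sup>2))" by (metis mult_sgn_abs)
  show "- c = k2 * a / d" using assms(1,3) by (simp add: field_simps)
qed

text \<open>
  The sign of the first torsion, which is constant and nonzero, decides between the two classes.
\<close>

lemma proper_biharmonic_order4:
  fixes \<gamma> :: "real \<Rightarrow> complex^3^3"
  assumes fr: "frenet_curve I \<gamma> 4 E k" and bi: "\<And>t. t \<in> I \<Longrightarrow> bitension I \<gamma> t = 0"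
  shows "holomorphic_helix I \<gamma> 4 E k"
    and "(\<forall>t\<in>I. 0 < ctorsion \<gamma> E 1 2 t) \<and> class_I3 I \<gamma> E k \<or>
      (\<forall>t\<in>I. ctorsion \<gamma> E 1 2 t < 0) \<and> class_I4 I \<gamma> E k"
proof -
  define \<tau> where "\<tau> = ctorsion \<gamma> E"
  have I: "nondeg_interval I" using fr by (simp add: frenet_curve_def curve_in_cproj_def)
  then obtain t0 where t0: "t0 \<in> I" unfolding nondeg_interval_def using interior_subset by blast
  have pos: "0 < k 1 t" "0 < k 2 t" "0 < k 3 t" if "t \<in> I" for t
    using fr that by (simp_all add: frenet_curve_def)
  obtain k1' k1'' where k1: "\<And>t. t \<in> I \<Longrightarrow> (k 1 has_real_derivative k1' t) (at t within I)"
    and k1': "\<And>t. t \<in> I \<Longrightarrow> (k1' has_real_derivative k1'' t) (at t within I)"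
    by (rule frenet_curvature_smooth [OF fr, of 1]) auto
  obtain k2' k2'' where k2: "\<And>t. t \<in> I \<Longrightarrow> (k 2 has_real_derivative k2' t) (at t within I)"
    and "\<And>t. t \<in> I \<Longrightarrow> (k2' has_real_derivative k2'' t) (at t within I)"
    by (rule frenet_curvature_smooth [OF fr, of 2]) auto
  have B: "k1' t = 0" "k1'' t = k 1 t * ((k 1 t)\<^sup>2 + (k 2 t)\<^sup>2 - 1 - 3 * (\<tau> 1 2 t)\<^sup>2)"
    "2 * k1' t * k 2 t + k 1 t * k2' t = - (3 * k 1 t * \<tau> 1 2 t * \<tau> 1 3 t)"
    "k 2 t * k 3 t = - 3 * \<tau> 1 2 t * \<tau> 1 4 t" if t: "t \<in> I" for t
    unfolding \<tau>_def
    by (rule bitension_zero_components [OF fr, of k1' k1'' k2']; blast intro: k1 k1' k2 t bi)+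
  note D = ctorsion_derivatives [OF fr, folded \<tau>_def]
  note R = ctorsion_relations [OF fr, folded \<tau>_def]
  have z1: "k1' t = 0" "k1'' t = 0" if "t \<in> I" for t
    using B(1) constant_derivative_zero [OF I that k1' [OF that], of 0] that by auto
  have sum: "(k 1 t)\<^sup>2 + (k 2 t)\<^sup>2 - 3 * (\<tau> 1 2 t)\<^sup>2 = 1" if "t \<in> I" for t
    using B(2) [OF that] z1(2) [OF that] pos(1) [OF that] by simp
  have k2t: "k2' t = - (3 * \<tau> 1 2 t * \<tau> 1 3 t)" if "t \<in> I" for t
  proof -
    have "k 1 t * (k2' t + 3 * \<tau> 1 2 t * \<tau> 1 3 t) = 0"
      using B(3) [OF that] z1(1) [OF that] by (simp add: algebra_simps)
    then show ?thesis using pos(1) [OF that] by (simp add: eq_neg_iff_add_eq_0)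
  qed
  have e: "k 2 t * k 3 t = - 3 * \<tau> 1 2 t * \<tau> 1 4 t" if "t \<in> I" for t
    using B(4) [OF that] .
  have nz: "\<tau> 1 2 t \<noteq> 0" if "t \<in> I" for t
    using e [OF that] pos [OF that] by auto
  have \<tau>13: "\<tau> 1 3 t = 0" if t: "t \<in> I" for t
  proof -
    \<comment> \<open>differentiating the second component gives the negative of the third one\<close>
    have "((\<lambda>t. (k 1 t)\<^sup>2 + (k 2 t)\<^sup>2 - 3 * (\<tau> 1 2 t)\<^sup>2) has_real_derivative
        2 * k 1 t * k1' t + 2 * k 2 t * k2' t - 6 * \<tau> 1 2 t * (k 2 t * \<tau> 1 3 t)) (at t within I)"
      by (rule derivative_eq_intros k1 [OF t] k2 [OF t] D(1) [OF t] refl | simp)+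
    from constant_derivative_zero [OF I t this sum]
    have "k 2 t * (\<tau> 1 2 t * \<tau> 1 3 t) = 0" using z1 [OF t] k2t [OF t] by simp
    then show ?thesis using pos(2) [OF t] nz [OF t] by simp
  qed
  have d13: "k 1 t * \<tau> 2 3 t - k 2 t * \<tau> 1 2 t + k 3 t * \<tau> 1 4 t = 0" if t: "t \<in> I" for t
    using constant_derivative_zero [OF I t D(2) [OF t] \<tau>13] .
  have A: "\<tau> 2 4 t = 0" "\<tau> 2 3 t = - \<tau> 1 4 t" "\<tau> 3 4 t = - \<tau> 1 2 t"
    "(k 1 t - k 3 t) * \<tau> 1 4 t = - (k 2 t * \<tau> 1 2 t)" "0 < k 1 t - k 3 t" if t: "t \<in> I" for t
    using torsion_matrix_algebra [OF pos [OF t] e [OF t] _ R(2) [OF t] _ R(4) [OF t] d13 [OF t]]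
      R(1,3) [OF t] \<tau>13 [OF t] by simp_all
  obtain c1 where c1: "\<And>t. t \<in> I \<Longrightarrow> k 1 t = c1"
    using zero_derivative_constant [OF I, of "k 1"] k1 z1 by metis
  have d: "(k 2 has_real_derivative 0) (at t within I)" "(\<tau> 1 2 has_real_derivative 0) (at t within I)"
    "(\<tau> 1 4 has_real_derivative 0) (at t within I)" if t: "t \<in> I" for t
    using k2 [OF t] k2t [OF t] D(1,3) [OF t] A(1) [OF t] \<tau>13 [OF t] by simp_all
  obtain c2 where c2: "\<And>t. t \<in> I \<Longrightarrow> k 2 t = c2"
    using zero_derivative_constant [OF I d(1)] by metis
  obtain a where a: "\<And>t. t \<in> I \<Longrightarrow> \<tau> 1 2 t = a"
    using zero_derivative_constant [OF I d(2)] by metis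
  obtain c where c: "\<And>t. t \<in> I \<Longrightarrow> \<tau> 1 4 t = c"
    using zero_derivative_constant [OF I d(3)] by metis
  have c3: "k 3 t = - 3 * a * c / c2" if "t \<in> I" for t
    using e [OF that] a [OF that] c [OF that] c2 [OF that] pos(2) [OF that] by (simp add: field_simps)
  show hh: "holomorphic_helix I \<gamma> 4 E k"
    unfolding holomorphic_helix_def helix_def
  proof (intro conjI fr ballI allI impI)
    fix i :: nat assume "i \<in> {1..<4}"
    then have "i = 1 \<or> i = 2 \<or> i = 3" by auto
    then show "k i constant_on I" using c1 c2 c3 by (auto simp: constant_on_def)
  next
    fix i j :: nat assume "1 \<le> i \<and> i < j \<and> j \<le> 4"
    then have "i = 1 \<and> j = 2 \<or> i = 1 \<and> j = 3 \<or> i = 1 \<and> j = 4 \<or> i = 2 \<and> j = 3 \<or> i = 2 \<and> j = 4 \<or> i = 3 \<and> j = 4"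
      by auto
    then have "\<tau> i j constant_on I"
      unfolding constant_on_def using a c \<tau>13 A(1-3) by auto
    then show "ctorsion \<gamma> E i j constant_on I" by (simp add: \<tau>_def)
  qed
  have dir: "\<tau> 1 2 t = sgn a * helix_nu k t" "\<tau> 2 3 t = k 2 t * \<tau> 1 2 t / (k 1 t - k 3 t)" if t: "t \<in> I" for t
    using torsion_direction [OF A(5) pos(2) A(4), OF t t t] R(1) [OF t] \<tau>13 [OF t] A(2) [OF t] a [OF t]
    by (simp_all add: helix_nu_def)
  have "a \<noteq> 0" using nz [OF t0] a [OF t0] by simp
  then consider "0 < a" | "a < 0" by linarith
  then show "(\<forall>t\<in>I. 0 < ctorsion \<gamma> E 1 2 t) \<and> class_I3 I \<gamma> E k \<or>
      (\<forall>t\<in>I. ctorsion \<gamma> E 1 2 t < 0) \<and> class_I4 I \<gamma> E k"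
  proof cases
    case 1
    have "class_I3 I \<gamma> E k"
      unfolding class_I3_def \<tau>_def [symmetric]
    proof (intro conjI hh ballI)
      fix t assume t: "t \<in> I"
      note * = A [OF t] dir [OF t] \<tau>13 [OF t] 1
      show "k 1 t \<noteq> k 3 t" "\<tau> 1 2 t = helix_nu k t" "- \<tau> 3 4 t = helix_nu k t"
        "\<tau> 2 3 t = k 2 t * helix_nu k t / (k 1 t - k 3 t)" "- \<tau> 1 4 t = k 2 t * helix_nu k t / (k 1 t - k 3 t)"
        "\<tau> 1 3 t = 0" "\<tau> 2 4 t = 0"
        using * by simp_all
    qed
    then show ?thesis using 1 a by (auto simp: \<tau>_def)
  next
    case 2
    have "class_I4 I \<gamma> E k"
      unfolding class_I4_def \<tau>_def [symmetric]
    proof (intro conjI hh ballI)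
      fix t assume t: "t \<in> I"
      note * = A [OF t] dir [OF t] \<tau>13 [OF t] 2
      show "k 1 t \<noteq> k 3 t" "\<tau> 1 2 t = - helix_nu k t" "- \<tau> 3 4 t = - helix_nu k t"
        "\<tau> 2 3 t = - (k 2 t * helix_nu k t / (k 1 t - k 3 t))" "- \<tau> 1 4 t = - (k 2 t * helix_nu k t / (k 1 t - k 3 t))"
        "\<tau> 1 3 t = 0" "\<tau> 2 4 t = 0"
        using * by simp_all
    qed
    then show ?thesis using 2 a by (auto simp: \<tau>_def)
  qed
qed

section \<open>Orbits of one-parameter groups of unitary matrices\<close>

lemma has_vector_derivative_vecI:
  fixes f :: "real \<Rightarrow> 'a::real_normed_vector^'n"
  assumes "\<And>i. ((\<lambda>x. f x $ i) has_vector_derivative f' $ i) (at x within S)"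
  shows "(f has_vector_derivative f') (at x within S)"
proof -
  have "((\<lambda>y. (1 / norm (y - x)) *\<^sub>R (f y - (f x + (y - x) *\<^sub>R f'))) \<longlongrightarrow> 0) (at x within S)"
  proof (rule vec_tendstoI)
    fix i
    show "((\<lambda>y. ((1 / norm (y - x)) *\<^sub>R (f y - (f x + (y - x) *\<^sub>R f'))) $ i) \<longlongrightarrow> 0 $ i) (at x within S)"
      using assms [of i] by (simp add: has_vector_derivative_def has_derivative_within)
  qed
  then show ?thesis
    by (simp add: has_vector_derivative_def has_derivative_within bounded_linear_scaleR_left)
qed

primrec mpow :: "complex^'n^'n \<Rightarrow> nat \<Rightarrow> complex^'n^'n" where
  "mpow A 0 = mat 1"
| "mpow A (Suc n) = mpow A n ** A"

text \<open>
  The matrix exponential \<open>exp (t A)\<close>, entry by entry a convergent power series in \<open>t\<close>, so that it can be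
  differentiated termwise.
\<close>

definition mexp :: "complex^'n^'n \<Rightarrow> real \<Rightarrow> complex^'n^'n" where
  "mexp A t = (\<chi> i j. \<Sum>n. mpow A n $ i $ j / fact n * of_real t ^ n)"

lemma mpow_bound:
  "cmod (mpow A n $ i $ j) \<le> (\<Sum>a\<in>UNIV. \<Sum>b\<in>UNIV. cmod (A $ a $ b)) ^ n"
proof (induction n arbitrary: j)
  case 0
  show ?case by (simp add: mat_def)
next
  case (Suc n)
  let ?C = "\<Sum>a\<in>UNIV. \<Sum>b\<in>UNIV. cmod (A $ a $ b)"
  have C0: "0 \<le> ?C" by (intro sum_nonneg) auto
  have "cmod (mpow A (Suc n) $ i $ j) \<le> (\<Sum>k\<in>UNIV. cmod (mpow A n $ i $ k) * cmod (A $ k $ j))"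
    by (simp add: matrix_matrix_mult_def) (intro sum_norm_le, simp add: norm_mult)
  also have "\<dots> \<le> (\<Sum>k\<in>UNIV. ?C ^ n * cmod (A $ k $ j))"
    by (intro sum_mono mult_right_mono Suc) auto
  also have "\<dots> = ?C ^ n * (\<Sum>k\<in>UNIV. cmod (A $ k $ j))"
    by (simp add: sum_distrib_left)
  also have "\<dots> \<le> ?C ^ n * ?C"
    using C0 by (intro mult_left_mono sum_mono member_le_sum) auto
  finally show ?case by (simp add: mult.commute)
qed

lemma mpow_summable: "summable (\<lambda>n. mpow A n $ i $ j / fact n * z ^ n)"
proof (rule summable_comparison_test')
  let ?C = "\<Sum>a\<in>UNIV. \<Sum>b\<in>UNIV. cmod (A $ a $ b)"
  show "summable (\<lambda>n. inverse (fact n) * (?C * cmod z) ^ n)" by (rule summable_exp)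
  show "cmod (mpow A n $ i $ j / fact n * z ^ n) \<le> inverse (fact n) * (?C * cmod z) ^ n" if "n \<ge> 0" for n
    using mult_right_mono [OF mpow_bound [of A n i j], of "cmod z ^ n"]
    by (simp add: norm_mult norm_divide norm_power power_mult_distrib field_simps)
qed

lemma mexp_has_vector_derivative:
  "(mexp A has_vector_derivative mexp A t ** A) (at t within S)"
proof (intro has_vector_derivative_vecI)
  fix i j
  define c where "c k n = mpow A n $ i $ k / fact n" for k n
  have s: "summable (\<lambda>n. c k n * z ^ n)" for k z
    unfolding c_def by (rule mpow_summable)
  have d: "diffs (c j) n = (\<Sum>k\<in>UNIV. c k n * A $ k $ j)" for n
  proof -
    have "of_nat (Suc n) * (x / fact (Suc n)) = x / fact n" for x :: complex
      by (simp del: of_nat_Suc)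
    then have "diffs (c j) n = mpow A (Suc n) $ i $ j / fact n"
      by (simp only: diffs_def c_def)
    then show ?thesis
      by (simp add: c_def matrix_matrix_mult_def sum_divide_distrib)
  qed
  have "(\<Sum>n. diffs (c j) n * of_real t ^ n) = (\<Sum>n. \<Sum>k\<in>UNIV. A $ k $ j * (c k n * of_real t ^ n))"
    unfolding d by (simp add: sum_distrib_left mult_ac)
  also have "\<dots> = (\<Sum>k\<in>UNIV. \<Sum>n. A $ k $ j * (c k n * of_real t ^ n))"
    by (intro suminf_sum summable_mult s)
  also have "\<dots> = (\<Sum>k\<in>UNIV. A $ k $ j * (\<Sum>n. c k n * of_real t ^ n))"
    by (intro sum.cong refl suminf_mult s)
  also have "\<dots> = (mexp A t ** A) $ i $ j"
    by (simp add: mexp_def matrix_matrix_mult_def c_def mult.commute)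
  finally have "((\<lambda>z. \<Sum>n. c j n * z ^ n) has_field_derivative (mexp A t ** A) $ i $ j) (at (of_real t))"
    using termdiffs_strong_converges_everywhere [OF s, of j "of_real t"] by simp
  then show "((\<lambda>t. mexp A t $ i $ j) has_vector_derivative (mexp A t ** A) $ i $ j) (at t within S)"
    using has_vector_derivative_real_field by (fastforce simp: mexp_def c_def)
qed

lemma mexp_zero: "mexp A 0 = mat 1"
  by (simp add: mexp_def vec_eq_iff powser_zero del: times_divide_eq_left)

lemma ctransp_has_vector_derivative:
  fixes f :: "real \<Rightarrow> complex^'n^'n"
  assumes "(f has_vector_derivative f') (at t within S)"
  shows "((\<lambda>s. ctransp (f s)) has_vector_derivative ctransp f') (at t within S)"
proof (rule bounded_linear.has_vector_derivative [OF _ assms])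
  show "bounded_linear (ctransp :: complex^'n^'n \<Rightarrow> complex^'n^'n)"
    by (rule linear_conv_bounded_linear [THEN iffD1], rule linearI)
      (simp_all add: ctransp_add ctransp_def vec_eq_iff)
qed

text \<open>
  For skew-Hermitian \<open>A\<close> the derivative of \<open>exp (t A) (exp (t A))\<^sup>*\<close> vanishes.
\<close>

lemma mexp_unitary:
  assumes "ctransp A = - A"
  shows "mexp A t ** ctransp (mexp A t) = mat 1" "ctransp (mexp A t) ** mexp A t = mat 1"
proof -
  have "((\<lambda>t. mexp A t ** ctransp (mexp A t)) has_vector_derivative
      mexp A t ** ctransp (mexp A t ** A) + mexp A t ** A ** ctransp (mexp A t)) (at t)" for t
    by (intro matrix_mult_has_vector_derivative ctransp_has_vector_derivative mexp_has_vector_derivative)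
  then have "((\<lambda>t. mexp A t ** ctransp (mexp A t)) has_vector_derivative 0) (at t)" for t
    by (simp add: ctransp_mult assms matrix_algebra)
  then obtain C where C: "\<And>t. mexp A t ** ctransp (mexp A t) = C"
    using has_vector_derivative_zero_constant [of UNIV] by auto
  have "ctransp (mat 1 :: complex^'a^'a) = mat 1"
    by (simp add: ctransp_def mat_def vec_eq_iff)
  then have "C = mat 1" using C [of 0] by (simp add: mexp_zero)
  with C show "mexp A t ** ctransp (mexp A t) = mat 1" by simp
  then show "ctransp (mexp A t) ** mexp A t = mat 1" by (simp add: matrix_left_right_inverse)
qed

definition conj_by :: "complex^'n^'n \<Rightarrow> complex^'n^'n \<Rightarrow> complex^'n^'n" where
  "conj_by U M = U ** M ** ctransp U"

locale unitary =
  fixes U :: "complex^'n^'n"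
  assumes left: "ctransp U ** U = mat 1"
begin

lemma cancel: "M ** ctransp U ** U = M"
  using left by (simp flip: matrix_mul_assoc)

lemma conj_by_mult: "conj_by U (M ** N) = conj_by U M ** conj_by U N"
  by (simp add: conj_by_def matrix_mul_assoc cancel)

lemma conj_by_linear:
  "conj_by U (M + N) = conj_by U M + conj_by U N" "conj_by U (M - N) = conj_by U M - conj_by U N"
  "conj_by U (r *\<^sub>R M) = r *\<^sub>R conj_by U M" "conj_by U (- M) = - conj_by U M" "conj_by U 0 = 0"
  by (simp_all add: conj_by_def matrix_algebra matrix_zero)

lemma conj_by_scalar: "conj_by U (mat c ** M) = mat c ** conj_by U M"
proof -
  have "U ** mat c = mat c ** U" by (rule scalar_matrix_commute)
  then show ?thesis by (simp add: conj_by_def matrix_mul_assoc)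
qed

lemma conj_by_ctransp: "ctransp (conj_by U M) = conj_by U (ctransp M)"
  by (simp add: conj_by_def ctransp_mult matrix_mul_assoc)

lemma conj_by_tproj: "tproj (conj_by U P) (conj_by U M) = conj_by U (tproj P M)"
  by (simp only: tproj_alt conj_by_mult conj_by_linear)

lemma conj_by_cplx_str: "cplx_str (conj_by U P) (conj_by U M) = conj_by U (cplx_str P M)"
  by (simp add: cplx_str_def conj_by_scalar flip: conj_by_mult conj_by_linear)

lemma conj_by_fs_metric: "fs_metric (conj_by U M) (conj_by U N) = fs_metric M N"
proof -
  have "conj_by U M \<bullet> conj_by U N = (U ** M) \<bullet> (U ** N ** ctransp U ** U)"
    using inner_mult_right [of "U ** M" "ctransp U"] by (simp add: conj_by_def)
  also have "\<dots> = M \<bullet> (ctransp U ** U ** N)"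
    using inner_mult_left [of U M] by (simp add: cancel matrix_mul_assoc)
  also have "\<dots> = M \<bullet> N" by (simp add: left)
  finally show ?thesis by (simp add: fs_metric_def)
qed

lemma conj_by_tangent: "X \<in> tangent_cproj P \<Longrightarrow> conj_by U X \<in> tangent_cproj (conj_by U P)"
  by (simp add: tangent_cproj_def conj_by_ctransp flip: conj_by_mult conj_by_linear)

text \<open>
  Conjugation maps \<open>hopf v\<close> to \<open>hopf (U *v v)\<close>. As the squared length of \<open>hopf v\<close> is the fourth power of
  the length of \<open>v\<close>, invariance of the metric also gives that \<open>U\<close> preserves lengths of vectors.
\<close>

lemma conj_by_cproj:
  assumes "P \<in> cproj" shows "conj_by U P \<in> cproj"
proof -
  obtain v where v: "norm v = 1" "P = hopf v" using assms by (rule cproj_obtain)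
  have "U ** outer v v ** ctransp U = outer (U *v v) (U *v v)"
    by (simp add: matrix_mult_outer) (metis ctransp_ctransp ctransp_mult ctransp_outer matrix_mult_outer)
  then have h: "conj_by U P = hopf (U *v v)" by (simp add: conj_by_def v hopf_def)
  have "outer v v \<bullet> outer v v = outer (U *v v) (U *v v) \<bullet> outer (U *v v) (U *v v)"
    using conj_by_fs_metric [of P P] unfolding h unfolding v(2) by (simp add: fs_metric_def hopf_def)
  then have "(norm (U *v v)) ^ 4 = 1 ^ 4"
    using v(1) by (simp add: inner_outer herm_self flip: of_real_power of_real_mult)
  then have "norm (U *v v) = 1"
    by (subst (asm) power_eq_iff_eq_base) auto
  then show ?thesis by (auto simp: h cproj_def)
qed

end

definition orbit :: "complex^'n^'n \<Rightarrow> complex^'n^'n \<Rightarrow> real \<Rightarrow> complex^'n^'n" where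
  "orbit A M t = conj_by (mexp A t) M"

lemma orbit_has_vector_derivative:
  assumes "ctransp A = - A"
  shows "(orbit A M has_vector_derivative orbit A (A ** M - M ** A) t) (at t within S)"
proof -
  have "((\<lambda>t. mexp A t ** M ** ctransp (mexp A t)) has_vector_derivative
      mexp A t ** M ** ctransp (mexp A t ** A)
        + (mexp A t ** 0 + mexp A t ** A ** M) ** ctransp (mexp A t)) (at t within S)"
    by (intro matrix_mult_has_vector_derivative ctransp_has_vector_derivative
        mexp_has_vector_derivative has_vector_derivative_const)
  then show ?thesis
    by (simp add: orbit_def [abs_def] conj_by_def ctransp_mult assms matrix_algebra matrix_zero add.commute)
qed

lemma orbit_smooth:
  assumes "ctransp A = - A" shows "smooth_curve S (orbit A M)"
  unfolding smooth_curve_def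
proof (intro exI conjI allI ballI)
  let ?F = "\<lambda>k. orbit A (((\<lambda>M. A ** M - M ** A) ^^ k) M)"
  show "?F 0 t = orbit A M t" for t by simp
  show "(?F k has_vector_derivative ?F (Suc k) t) (at t within S)" for k t
    using orbit_has_vector_derivative [OF assms] by simp
qed

lemma nondeg_interval_UNIV: "nondeg_interval UNIV"
  by (simp add: nondeg_interval_def)

lemma orbit_cov_along:
  assumes "ctransp A = - A"
  shows "cov_along UNIV (orbit A P) (orbit A M) t = orbit A (tproj P (A ** M - M ** A)) t"
proof -
  interpret unitary "mexp A t" using mexp_unitary(2) [OF assms] by unfold_locales
  have "cov_along UNIV (orbit A P) (orbit A M) t = tproj (orbit A P t) (orbit A (A ** M - M ** A) t)"
    by (rule cov_along_eq [OF nondeg_interval_UNIV _ orbit_has_vector_derivative [OF assms]]) auto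
  then show ?thesis by (simp add: orbit_def conj_by_tproj)
qed

text \<open>
  Conjugation by unitary matrices preserves all structures, so covariant derivatives along an orbit are
  computed at time 0: there they are the tangential part of the commutator with the generator.
\<close>

lemma orbit_frenet_curve:
  fixes A P :: "complex^'n^'n"
  assumes A: "ctransp A = - A" and P: "P \<in> cproj" and d: "1 \<le> d" "d \<le> 2 * (CARD('n) - 1)"
    and T: "\<And>i. i \<in> {1..d} \<Longrightarrow> X i \<in> tangent_cproj P"
    and on: "\<And>i j. i \<in> {1..d} \<Longrightarrow> j \<in> {1..d} \<Longrightarrow> fs_metric (X i) (X j) = (if i = j then 1 else 0)"
    and pos: "\<And>i. i \<in> {1..<d} \<Longrightarrow> 0 < \<kappa> i"
    and vel: "A ** P - P ** A = X 1"
    and frenet: "\<And>i. i \<in> {1..d} \<Longrightarrow> tproj P (A ** X i - X i ** A) =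
        (if i = 1 then 0 else - (\<kappa> (i - 1) *\<^sub>R X (i - 1))) + (if i = d then 0 else \<kappa> i *\<^sub>R X (i + 1))"
  shows "frenet_curve UNIV (orbit A P) d (\<lambda>i. orbit A (X i)) (\<lambda>i _. \<kappa> i)"
proof -
  have U: "unitary (mexp A t)" for t using mexp_unitary(2) [OF A] by unfold_locales
  note L = unitary.conj_by_linear [OF U]
  have "velocity UNIV (orbit A P) t = orbit A (X 1) t" for t
    using vector_derivative_at [OF orbit_has_vector_derivative [OF A]] vel by (simp add: velocity_def)
  then show ?thesis
    unfolding frenet_curve_def curve_in_cproj_def field_along_def
    using d T pos on nondeg_interval_UNIV
    by (auto simp: orbit_smooth [OF A] orbit_cov_along [OF A] frenet simp del: One_nat_def)
      (auto simp: orbit_def L unitary.conj_by_cproj [OF U P] unitary.conj_by_tangent [OF U] 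
        unitary.conj_by_fs_metric [OF U] simp del: One_nat_def)
qed

section \<open>Biharmonic helices with prescribed torsions\<close>

definition base_point :: "complex^3^3" where
  "base_point = vector [vector [1, 0, 0], 0, 0]"

text \<open>
  The tangent vector at \<open>base_point\<close> with horizontal lift \<open>(0, a, b)\<close>.
\<close>

definition tangent_at_base :: "complex \<Rightarrow> complex \<Rightarrow> complex^3^3" where
  "tangent_at_base a b = vector [vector [0, cnj a, cnj b], vector [a, 0, 0], vector [b, 0, 0]]"

text \<open>
  The first column sends the base vector to \<open>(0, 1, 0)\<close>, so the orbit starts with the velocity
  \<open>tangent_at_base 1 0\<close>. The lower block acts on horizontal lifts as the covariant derivative along the
  orbit.
\<close>

definition generator :: "complex \<Rightarrow> complex \<Rightarrow> complex \<Rightarrow> complex^3^3" where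
  "generator p q r = vector [vector [0, -1, 0], vector [1, p, q], vector [0, q, r]]"

lemmas matrix_3 = vec_eq_iff forall_3 sum_3 matrix_matrix_mult_def ctransp_def mat_def

lemma base_point_cproj: "base_point \<in> cproj"
proof -
  have "base_point = hopf (axis 1 1)"
    by (simp add: base_point_def hopf_def outer_def axis_def matrix_3)
  then show ?thesis by (auto simp: cproj_def)
qed

lemma tangent_at_base_tangent: "tangent_at_base a b \<in> tangent_cproj base_point"
  by (simp add: tangent_cproj_def tangent_at_base_def base_point_def matrix_3)

lemma tangent_at_base_fs_metric: "fs_metric (tangent_at_base a b) (tangent_at_base c d) = Re (a * cnj c + b * cnj d)"
  by (simp add: fs_metric_def tangent_at_base_def inner_vec_def inner_complex_def sum_3)

lemma tangent_at_base_cplx_str: "cplx_str base_point (tangent_at_base a b) = tangent_at_base (\<i> * a) (\<i> * b)"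
  by (simp add: cplx_str_def tangent_at_base_def base_point_def matrix_3)

lemma tangent_at_base_linear: "tangent_at_base a b + tangent_at_base c d = tangent_at_base (a + c) (b + d)"
  "r *\<^sub>R tangent_at_base a b = tangent_at_base (r *\<^sub>R a) (r *\<^sub>R b)" "- tangent_at_base a b = tangent_at_base (- a) (- b)"
  by (simp_all add: tangent_at_base_def matrix_3)

lemma generator_commutator:
  assumes "cnj p = - p" "cnj q = - q" "cnj r = - r"
  shows "ctransp (generator p q r) = - generator p q r"
    "generator p q r ** base_point - base_point ** generator p q r = tangent_at_base 1 0"
    "tproj base_point (generator p q r ** tangent_at_base a b - tangent_at_base a b ** generator p q r) = tangent_at_base (p * a + q * b) (q * a + r * b)"
  using assms
  by (simp_all add: generator_def tangent_at_base_def base_point_def matrix_3 tproj_def algebra_simps)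

text \<open>
  The torsions \<open>\<tau>\<^sub>1\<^sub>2 = - \<tau>\<^sub>3\<^sub>4 = c\<close>, \<open>\<tau>\<^sub>2\<^sub>3 = - \<tau>\<^sub>1\<^sub>4 = s\<close> and \<open>E\<^sub>1 = (1, 0)\<close>, \<open>E\<^sub>3 = (0, 1)\<close> in the plane of lifts
  determine \<open>E\<^sub>2 = \<i> (- c, s)\<close> and \<open>E\<^sub>4 = \<i> (s, c)\<close>. The Frenet equations for \<open>E\<^sub>1\<close> and \<open>E\<^sub>3\<close> then prescribe the
  columns of the lower block of the generator. This block is skew-Hermitian exactly if
  \<open>k\<^sub>1 s = k\<^sub>2 c + k\<^sub>3 s\<close>. The other two equations make the orbit biharmonic.
\<close>

lemma homogeneous_biharmonic_helix:
  fixes c s k1 k2 k3 :: real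
  assumes k: "0 < k1" "0 < k2" "0 < k3" and cs: "c\<^sup>2 + s\<^sup>2 = 1" and e1: "(k1 - k3) * s = k2 * c"
    and e2: "k1\<^sup>2 + k2\<^sup>2 = 1 + 3 * c\<^sup>2" and e3: "k2 * k3 = 3 * c * s"
  defines "\<kappa> \<equiv> \<lambda>i::nat. if i = 1 then k1 else if i = 2 then k2 else k3"
  obtains \<gamma> :: "real \<Rightarrow> complex^3^3" and E where
    "proper_biharmonic UNIV \<gamma>" "frenet_curve UNIV \<gamma> 4 E (\<lambda>i _. \<kappa> i)" "\<And>t. ctorsion \<gamma> E 1 2 t = c"
proof -
  define A where "A = generator (- \<i> * k1 * c) (\<i> * k1 * s) (\<i> * (k3 * c - k2 * s))"
  define X :: "nat \<Rightarrow> complex^3^3" where "X i = (if i = 1 then tangent_at_base 1 0 else if i = 2 then tangent_at_base (- \<i> * c) (\<i> * s)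
    else if i = 3 then tangent_at_base 0 1 else tangent_at_base (\<i> * s) (\<i> * c))" for i
  have X: "X 1 = tangent_at_base 1 0" "X 2 = tangent_at_base (- \<i> * c) (\<i> * s)" "X 3 = tangent_at_base 0 1" "X 4 = tangent_at_base (\<i> * s) (\<i> * c)"
    by (simp_all add: X_def)
  have K: "\<kappa> 1 = k1" "\<kappa> 2 = k2" "\<kappa> 3 = k3" by (simp_all add: \<kappa>_def)
  have four: "i = 1 \<or> i = 2 \<or> i = 3 \<or> i = 4" if "i \<in> {1..4}" for i :: nat using that by auto
  have G: "ctransp A = - A" "A ** base_point - base_point ** A = X 1"
    "tproj base_point (A ** tangent_at_base a b - tangent_at_base a b ** A) =
      tangent_at_base ((- \<i> * k1 * c) * a + (\<i> * k1 * s) * b) ((\<i> * k1 * s) * a + (\<i> * (k3 * c - k2 * s)) * b)" for a b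
    unfolding A_def X by (rule generator_commutator; simp)+
  have T: "X i \<in> tangent_cproj base_point" for i
    by (simp add: X_def tangent_at_base_tangent)
  have cc: "c * c + s * s = 1" "s * s + c * c = 1" using cs by (simp_all add: power2_eq_square)
  have on: "fs_metric (X i) (X j) = (if i = j then 1 else 0)" if "i \<in> {1..4}" "j \<in> {1..4}" for i j
    using four [OF that(1)] four [OF that(2)] cc by (elim disjE) (simp_all add: X tangent_at_base_fs_metric del: One_nat_def)
  have r: "k1 * s = k2 * c + k3 * s" using e1 by (simp add: algebra_simps)
  have r2: "k1 * (c * c) + k1 * (s * s) = k1" "k1 * s * c + (k3 * c - k2 * s) * - s = k2"
    "k1 * s * s + (k3 * c - k2 * s) * c = k3"
  proof -
    show "k1 * (c * c) + k1 * (s * s) = k1" using cc by (simp flip: distrib_left)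
    have "k1 * s * c + (k3 * c - k2 * s) * - s = k2 * (c * c + s * s)"
      unfolding r by (simp add: algebra_simps)
    then show "k1 * s * c + (k3 * c - k2 * s) * - s = k2" by (simp add: cc)
    have "k1 * s * s + (k3 * c - k2 * s) * c = k3 * (c * c + s * s)"
      unfolding r by (simp add: algebra_simps)
    then show "k1 * s * s + (k3 * c - k2 * s) * c = k3" by (simp add: cc)
  qed
  have fX: "tproj base_point (A ** X 1 - X 1 ** A) = k1 *\<^sub>R X 2"
    "tproj base_point (A ** X 2 - X 2 ** A) = - (k1 *\<^sub>R X 1) + k2 *\<^sub>R X 3"
    "tproj base_point (A ** X 3 - X 3 ** A) = - (k2 *\<^sub>R X 2) + k3 *\<^sub>R X 4"
    unfolding X G(3) tangent_at_base_linear using r r2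
    by (auto intro!: arg_cong2 [of _ _ _ _ tangent_at_base] simp: complex_eq_iff algebra_simps)
  have "tproj base_point (A ** X 4 - X 4 ** A) = - (k3 *\<^sub>R X 3)"
    unfolding X G(3) tangent_at_base_linear using r2(3)
    by (auto intro!: arg_cong2 [of _ _ _ _ tangent_at_base] simp: complex_eq_iff algebra_simps)
  note fX = fX this
  have frenet: "tproj base_point (A ** X i - X i ** A) =
      (if i = 1 then 0 else - (\<kappa> (i - 1) *\<^sub>R X (i - 1))) + (if i = 4 then 0 else \<kappa> i *\<^sub>R X (i + 1))"
    if "i \<in> {1..4}" for i
    using four [OF that] fX by (elim disjE) (simp_all add: \<kappa>_def eval_nat_numeral)
  define \<gamma> where "\<gamma> = orbit A base_point"
  define E where "E i = orbit A (X i)" for i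
  have fr: "frenet_curve UNIV \<gamma> 4 E (\<lambda>i _. \<kappa> i)"
    unfolding \<gamma>_def E_def [abs_def]
    by (rule orbit_frenet_curve [OF G(1) base_point_cproj _ _ T on _ G(2) frenet])
      (use k in \<open>auto simp: \<kappa>_def\<close>)
  have U: "unitary (mexp A t)" for t using mexp_unitary(2) [OF G(1)] by unfold_locales
  have J: "cplx_str (\<gamma> t) (E i t) = orbit A (cplx_str base_point (X i)) t" for i t
    by (simp add: \<gamma>_def E_def orbit_def unitary.conj_by_cplx_str [OF U])
  have \<tau>: "ctorsion \<gamma> E 1 2 t = c" for t
    unfolding ctorsion_def J unfolding E_def orbit_def unitary.conj_by_fs_metric [OF U]
    by (simp add: X tangent_at_base_cplx_str tangent_at_base_fs_metric del: One_nat_def)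
  have "cplx_str base_point (X 1) = - c *\<^sub>R X 2 + s *\<^sub>R X 4"
    unfolding X tangent_at_base_cplx_str tangent_at_base_linear using cc
    by (auto intro!: arg_cong2 [of _ _ _ _ tangent_at_base] simp: complex_eq_iff algebra_simps)
  then have J1: "cplx_str (\<gamma> t) (E 1 t) = - c *\<^sub>R E 2 t + s *\<^sub>R E 4 t" for t
    unfolding J by (simp add: E_def orbit_def unitary.conj_by_linear [OF U])
  have bi: "bitension UNIV \<gamma> t = 0" for t
  proof -
    have "bitension UNIV \<gamma> t = (k1 * (1 + 3 * c\<^sup>2 - (k1\<^sup>2 + k2\<^sup>2))) *\<^sub>R E 2 t + (k1 * (k2 * k3 - 3 * c * s)) *\<^sub>R E 4 t"
      using bitension_frenet(2) [OF fr, of "\<lambda>_. 0" "\<lambda>_. 0" "\<lambda>_. 0" t]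
      by (simp add: J1 \<tau> K vec_eq_iff scaleR_conv_of_real algebra_simps power2_eq_square del: One_nat_def)
    then show ?thesis by (simp add: e2 e3)
  qed
  have "tension UNIV \<gamma> t \<noteq> 0" for t
  proof
    assume "tension UNIV \<gamma> t = 0"
    then have "k1 *\<^sub>R E 2 t = 0"
      using bitension_frenet(1) [OF fr, of "\<lambda>_. 0" "\<lambda>_. 0" "\<lambda>_. 0" t] by (simp add: K del: One_nat_def)
    then have "fs_metric (E 2 t) (E 2 t) = 0" using k by (simp add: fs_metric_linear)
    moreover have "fs_metric (E 2 t) (E 2 t) = 1" using fr by (simp add: frenet_curve_def)
    ultimately show False by simp
  qed
  then have "proper_biharmonic UNIV \<gamma>"
    using fr bi by (auto simp: proper_biharmonic_def biharmonic_curve_def harmonic_curve_def frenet_curve_def)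
  then show thesis using that fr \<tau> by blast
qed

text \<open>
  The equation for \<open>k2 * k3\<close> and the linear relation are solved for \<open>k3\<close> and \<open>k1\<close>. With
  \<open>y = (k2 / s)\<^sup>2\<close> one gets \<open>k1\<^sup>2 = c\<^sup>2 (3 + y)\<^sup>2 / y\<close>, and the equation for \<open>k1\<^sup>2 + k2\<^sup>2\<close> becomes the
  quadratic equation for \<open>y\<close>.
\<close>

lemma biharmonic_curvatures:
  fixes c s y :: real
  assumes cs: "c\<^sup>2 + s\<^sup>2 = 1" and y: "0 < y" "y\<^sup>2 - (1 - 3 * c\<^sup>2) * y + 9 * c\<^sup>2 = 0" and p: "0 < c * s"
  defines "k2 \<equiv> \<bar>s\<bar> * sqrt y"
  defines "k3 \<equiv> 3 * c * s / k2"
  defines "k1 \<equiv> k3 + k2 * c / s"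
  shows "0 < k1" "0 < k2" "0 < k3" "(k1 - k3) * s = k2 * c" "k1\<^sup>2 + k2\<^sup>2 = 1 + 3 * c\<^sup>2" "k2 * k3 = 3 * c * s"
proof -
  have s: "s \<noteq> 0" using p by auto
  show k2: "0 < k2" using s y by (simp add: k2_def)
  show k3: "0 < k3" using k2 p by (simp add: k3_def mult.assoc)
  have "0 < c / s" using p by (auto simp: zero_less_divide_iff zero_less_mult_iff)
  then have "0 < k2 * (c / s)" using k2 by (rule mult_pos_pos [rotated])
  then show "0 < k1" using k3 by (simp add: k1_def)
  show "(k1 - k3) * s = k2 * c" using s by (simp add: k1_def)
  show "k2 * k3 = 3 * c * s" using k2 by (simp add: k3_def)
  have k22: "k2\<^sup>2 = s\<^sup>2 * y" using y by (simp add: k2_def power_mult_distrib)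
  have "k1 * k2 = (c / s) * (3 * s\<^sup>2 + k2\<^sup>2)"
    using s k2 by (simp add: k1_def k3_def field_simps power2_eq_square)
  also have "\<dots> = c * s * (3 + y)" unfolding k22 using s by (simp add: field_simps power2_eq_square)
  finally have "k1\<^sup>2 * k2\<^sup>2 = c\<^sup>2 * s\<^sup>2 * (3 + y)\<^sup>2" by (metis power_mult_distrib)
  then have "s\<^sup>2 * (k1\<^sup>2 * y) = s\<^sup>2 * (c\<^sup>2 * (3 + y)\<^sup>2)" unfolding k22 by (simp add: algebra_simps)
  then have "k1\<^sup>2 * y = c\<^sup>2 * (3 + y)\<^sup>2" using s by simp
  then have "(k1\<^sup>2 + k2\<^sup>2) * y = c\<^sup>2 * (3 + y)\<^sup>2 + s\<^sup>2 * y\<^sup>2"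
    unfolding k22 by (simp add: algebra_simps power2_eq_square)
  also have "\<dots> = (c\<^sup>2 + s\<^sup>2) * y\<^sup>2 + 6 * c\<^sup>2 * y + 9 * c\<^sup>2"
    by (simp add: algebra_simps power2_eq_square)
  also have "\<dots> = (1 + 3 * c\<^sup>2) * y" using y(2) cs by (simp add: algebra_simps)
  finally show "k1\<^sup>2 + k2\<^sup>2 = 1 + 3 * c\<^sup>2" using y by simp
qed

text \<open>
  The discriminant of the quadratic equation is \<open>inner_radicand \<alpha>\<close>; the sum and the product of the
  roots are positive.
\<close>

lemma inner_radicand_roots:
  assumes r: "0 < inner_radicand \<alpha>" and c: "3 * (cos \<alpha>)\<^sup>2 < 1" and s: "s = 1 \<or> s = (- 1 :: real)" and nz: "cos \<alpha> \<noteq> 0"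
  defines "y \<equiv> (1 - 3 * (cos \<alpha>)\<^sup>2 + s * sqrt (inner_radicand \<alpha>)) / 2"
  shows "0 < y" "y\<^sup>2 - (1 - 3 * (cos \<alpha>)\<^sup>2) * y + 9 * (cos \<alpha>)\<^sup>2 = 0"
proof -
  define b q where "b = 1 - 3 * (cos \<alpha>)\<^sup>2" and "q = sqrt (inner_radicand \<alpha>)"
  have q: "q\<^sup>2 = b\<^sup>2 - 36 * (cos \<alpha>)\<^sup>2" "0 < q"
  proof -
    show "0 < q" using r by (simp add: q_def)
    have "q\<^sup>2 = inner_radicand \<alpha>" using r by (simp add: q_def)
    then show "q\<^sup>2 = b\<^sup>2 - 36 * (cos \<alpha>)\<^sup>2"
      by (simp add: inner_radicand_def b_def power2_eq_square power4_eq_xxxx algebra_simps)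
  qed
  have s2: "s * s = 1" using s by auto
  have y: "y = (b + s * q) / 2" by (simp add: y_def b_def q_def)
  have "(s * q)\<^sup>2 = q\<^sup>2" using s by auto
  then have "y\<^sup>2 - b * y = (q\<^sup>2 - b\<^sup>2) / 4"
    unfolding y by (simp add: field_simps power2_eq_square)
  then show "y\<^sup>2 - (1 - 3 * (cos \<alpha>)\<^sup>2) * y + 9 * (cos \<alpha>)\<^sup>2 = 0"
    using q by (simp add: b_def)
  have "q\<^sup>2 < b\<^sup>2" using q nz by simp
  then have "q < b" using c by (simp add: b_def power_less_imp_less_base)
  then show "0 < y" using s q c by (auto simp: y b_def)
qed

text \<open>
  Both families at once: the torsions are \<open>c = - cos \<alpha>\<close> and \<open>s = sin \<alpha>\<close>, of equal sign by the last
  assumption, and the sign of \<open>c\<close> decides the class.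
\<close>

lemma biharmonic_helices_exist:
  assumes r: "0 < inner_radicand \<alpha>" and c: "3 * (cos \<alpha>)\<^sup>2 < 1" and p: "cos \<alpha> * sin \<alpha> < 0"
  shows "\<exists>(\<gamma> :: real \<Rightarrow> real \<Rightarrow> complex^3^3) E k.
     (\<forall>s\<in>{1, -1}.
        proper_biharmonic UNIV (\<gamma> s) \<and>
        (if cos \<alpha> < 0 then class_I3 UNIV (\<gamma> s) (E s) (k s) else class_I4 UNIV (\<gamma> s) (E s) (k s)) \<and>
        (\<forall>t. k s 2 t = \<bar>sin \<alpha>\<bar> / sqrt 2 *
                 sqrt (1 - 3 * (cos \<alpha>)\<^sup>2 + s * sqrt (inner_radicand \<alpha>)) \<and>
             k s 3 t = - (3 / (2 * k s 2 t)) * sin (2 * \<alpha>) \<and>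
             k s 1 t = - (1 / sin \<alpha>) * (k s 2 t * cos \<alpha> - k s 3 t * sin \<alpha>))) \<and>
     (\<forall>t. k 1 2 t \<noteq> k (-1) 2 t)"
proof -
  define y where "y s = (1 - 3 * (cos \<alpha>)\<^sup>2 + s * sqrt (inner_radicand \<alpha>)) / 2" for s
  define k2 where "k2 s = \<bar>sin \<alpha>\<bar> * sqrt (y s)" for s
  define k3 where "k3 s = 3 * (- cos \<alpha>) * sin \<alpha> / k2 s" for s
  define k1 where "k1 s = k3 s + k2 s * (- cos \<alpha>) / sin \<alpha>" for s
  define k where "k s i = (\<lambda>t::real. if i = 1 then k1 s else if i = 2 then k2 s else k3 s)" for s and i :: nat
  have nz: "cos \<alpha> \<noteq> 0" "sin \<alpha> \<noteq> 0" using p by auto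
  have "\<exists>(\<gamma> :: real \<Rightarrow> complex^3^3) E. proper_biharmonic UNIV \<gamma> \<and> 
      (if cos \<alpha> < 0 then class_I3 UNIV \<gamma> E (k s) else class_I4 UNIV \<gamma> E (k s))" if s: "s = 1 \<or> s = - 1" for s
  proof -
    have cs: "(- cos \<alpha>)\<^sup>2 + (sin \<alpha>)\<^sup>2 = 1" by simp
    have q: "0 < - cos \<alpha> * sin \<alpha>" using p by simp
    note Y = inner_radicand_roots [OF r c s nz(1), folded y_def]
    have "(y s)\<^sup>2 - (1 - 3 * (- cos \<alpha>)\<^sup>2) * y s + 9 * (- cos \<alpha>)\<^sup>2 = 0" using Y(2) by simp
    note C = biharmonic_curvatures [OF cs Y(1) this q, folded k2_def, folded k3_def, folded k1_def]
    obtain \<gamma> :: "real \<Rightarrow> complex^3^3" and E where g: "proper_biharmonic UNIV \<gamma>" 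
      "frenet_curve UNIV \<gamma> 4 E (k s)" "\<And>t. ctorsion \<gamma> E 1 2 t = - cos \<alpha>"
      by (rule homogeneous_biharmonic_helix [OF C(1-3) cs C(4-6)]) (auto simp: k_def [abs_def])
    have "bitension UNIV \<gamma> t = 0" for t using g by (simp add: proper_biharmonic_def biharmonic_curve_def)
    then show ?thesis
      using proper_biharmonic_order4(2) [OF g(2)] g(1) g(3) nz by (intro exI [of _ \<gamma>] exI [of _ E]) auto
  qed
  then obtain \<gamma> E where g: "\<And>s. s = 1 \<or> s = - 1 \<Longrightarrow> proper_biharmonic UNIV (\<gamma> s :: real \<Rightarrow> complex^3^3) \<and> 
      (if cos \<alpha> < 0 then class_I3 UNIV (\<gamma> s) (E s) (k s) else class_I4 UNIV (\<gamma> s) (E s) (k s))"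
    by metis
  have k: "k s 1 t = k1 s" "k s 2 t = k2 s" "k s 3 t = k3 s" for s t by (simp_all add: k_def)
  have "k2 s = \<bar>sin \<alpha>\<bar> / sqrt 2 * sqrt (1 - 3 * (cos \<alpha>)\<^sup>2 + s * sqrt (inner_radicand \<alpha>))" for s
    by (simp add: k2_def y_def real_sqrt_divide)
  moreover have "k3 s = - (3 / (2 * k2 s)) * sin (2 * \<alpha>)" for s
    by (simp add: k3_def sin_double)
  moreover have "k1 s = - (1 / sin \<alpha>) * (k2 s * cos \<alpha> - k3 s * sin \<alpha>)" for s
    using nz by (simp add: k1_def field_simps)
  moreover have "k2 1 \<noteq> k2 (- 1)"
    using nz r by (simp add: k2_def y_def)
  ultimately show ?thesis
    using g unfolding k by (intro exI [of _ \<gamma>] exI [of _ E] exI [of _ k]) (auto simp: k simp del: One_nat_def)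
qed

text \<open>
  The bound on \<open>\<beta>\<close> says \<open>- cos \<beta> < (2 - sqrt 3) / sqrt 2\<close>, whose square \<open>(7 - 4 sqrt 3) / 2\<close> is less than
  \<open>1 / 3\<close>. So the sum \<open>1 - 3 (cos \<beta>)\<^sup>2\<close> of the roots of the quadratic equation is positive.
\<close>

lemma cos_range:
  assumes "pi / 2 < \<beta>" "\<beta> < arccos (- ((2 - sqrt 3) / sqrt 2))"
  shows "cos \<beta> < 0" "0 < sin \<beta>" "3 * (cos \<beta>)\<^sup>2 < 1"
proof -
  define m where "m = (2 - sqrt 3) / sqrt 2"
  have s3: "sqrt 3 < 2" "17 / 10 < sqrt 3"
    by (rule real_less_lsqrt real_less_rsqrt; simp add: power2_eq_square)+
  have m: "0 < m" "3 * m\<^sup>2 < 1"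
  proof -
    show "0 < m" using s3 by (simp add: m_def)
    have "m\<^sup>2 = (7 - 4 * sqrt 3) / 2" by (simp add: m_def power_divide power2_diff)
    then show "3 * m\<^sup>2 < 1" using s3 by simp
  qed
  have "m < 1" 
  proof (rule power_less_imp_less_base [of _ 2])
    show "m\<^sup>2 < 1\<^sup>2" using m(2) by (smt (verit) one_power2 zero_le_power2)
  qed simp
  then have ar: "cos (arccos (- m)) = - m" "arccos (- m) \<le> pi"
    using m by (auto intro: arccos_bounded [THEN conjunct2] arccos_ubound)
  have b: "\<beta> < arccos (- m)" using assms by (simp add: m_def)
  have "cos (arccos (- m)) < cos \<beta>"
    using assms b ar pi_gt_zero by (intro cos_monotone_0_pi) auto
  then have c: "- m < cos \<beta>" using ar by simp
  show n: "cos \<beta> < 0" 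
    using cos_monotone_0_pi [of "pi / 2" \<beta>] assms b ar by simp
  show "0 < sin \<beta>" using assms b ar pi_gt_zero by (intro sin_gt_zero) auto
  have "(cos \<beta>)\<^sup>2 < m\<^sup>2"
    using power_strict_mono [of "- cos \<beta>" m 2] c n by simp
  then show "3 * (cos \<beta>)\<^sup>2 < 1" using m by simp
qed

theorem theorem6p1:
  shows
    "(\<forall>I (\<gamma> :: real \<Rightarrow> complex^3^3) E k.
        frenet_curve I \<gamma> 4 E k \<and> proper_biharmonic I \<gamma> \<longrightarrow>
          holomorphic_helix I \<gamma> 4 E k \<and>
          (class_I3 I \<gamma> E k \<or> class_I4 I \<gamma> E k) \<and>
          ((\<forall>t\<in>I. 0 < ctorsion \<gamma> E 1 2 t \<and> 0 < ctorsion \<gamma> E 2 3 t) \<longrightarrow> class_I3 I \<gamma> E k) \<and>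
          ((\<forall>t\<in>I. ctorsion \<gamma> E 1 2 t < 0 \<and> ctorsion \<gamma> E 2 3 t < 0) \<longrightarrow> class_I4 I \<gamma> E k))
     \<and>
     (\<forall>\<alpha>::real. pi / 2 < \<alpha> \<and> \<alpha> < arccos (- ((2 - sqrt 3) / sqrt 2)) \<and> 0 < inner_radicand \<alpha> \<longrightarrow>
        (\<exists>(\<gamma> :: real \<Rightarrow> real \<Rightarrow> complex^3^3) E k.
           (\<forall>s\<in>{1, -1}.
              proper_biharmonic UNIV (\<gamma> s) \<and> class_I3 UNIV (\<gamma> s) (E s) (k s) \<and>
              (\<forall>t. k s 2 t = sin \<alpha> / sqrt 2 *
                       sqrt (1 - 3 * (cos \<alpha>)\<^sup>2 + s * sqrt (inner_radicand \<alpha>)) \<and>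
                   k s 3 t = - (3 / (2 * k s 2 t)) * sin (2 * \<alpha>) \<and>
                   k s 1 t = - (1 / sin \<alpha>) * (k s 2 t * cos \<alpha> - k s 3 t * sin \<alpha>))) \<and>
           (\<forall>t. k 1 2 t \<noteq> k (-1) 2 t)))
     \<and>
     (\<forall>\<alpha>::real. 3 * pi / 2 < \<alpha> \<and> \<alpha> < pi + arccos (- ((2 - sqrt 3) / sqrt 2)) \<and> 0 < inner_radicand \<alpha> \<longrightarrow>
        (\<exists>(\<gamma> :: real \<Rightarrow> real \<Rightarrow> complex^3^3) E k.
           (\<forall>s\<in>{1, -1}.
              proper_biharmonic UNIV (\<gamma> s) \<and> class_I4 UNIV (\<gamma> s) (E s) (k s) \<and>
              (\<forall>t. k s 2 t = - (sin \<alpha> / sqrt 2) *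
                       sqrt (1 - 3 * (cos \<alpha>)\<^sup>2 + s * sqrt (inner_radicand \<alpha>)) \<and>
                   k s 3 t = - (3 / (2 * k s 2 t)) * sin (2 * \<alpha>) \<and>
                   k s 1 t = - (1 / sin \<alpha>) * (k s 2 t * cos \<alpha> - k s 3 t * sin \<alpha>))) \<and>
           (\<forall>t. k 1 2 t \<noteq> k (-1) 2 t)))"
proof (intro conjI allI impI)
  fix I and \<gamma> :: "real \<Rightarrow> complex^3^3" and E k
  assume *: "frenet_curve I \<gamma> 4 E k \<and> proper_biharmonic I \<gamma>"
  then have fr: "frenet_curve I \<gamma> 4 E k" and "\<And>t. t \<in> I \<Longrightarrow> bitension I \<gamma> t = 0"
    by (auto simp: proper_biharmonic_def biharmonic_curve_def)
  note H = proper_biharmonic_order4 [OF this]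
  have "nondeg_interval I" using fr by (simp add: frenet_curve_def curve_in_cproj_def)
  then obtain t where t: "t \<in> I" unfolding nondeg_interval_def using interior_subset by blast
  show "holomorphic_helix I \<gamma> 4 E k" by (rule H(1))
  show "class_I3 I \<gamma> E k \<or> class_I4 I \<gamma> E k" using H(2) by blast
  show "class_I3 I \<gamma> E k" if "\<forall>t\<in>I. 0 < ctorsion \<gamma> E 1 2 t \<and> 0 < ctorsion \<gamma> E 2 3 t"
    using H(2) that t by (meson less_asym)
  show "class_I4 I \<gamma> E k" if "\<forall>t\<in>I. ctorsion \<gamma> E 1 2 t < 0 \<and> ctorsion \<gamma> E 2 3 t < 0"
    using H(2) that t by (meson less_asym)
next
  fix \<alpha> :: real
  assume *: "pi / 2 < \<alpha> \<and> \<alpha> < arccos (- ((2 - sqrt 3) / sqrt 2)) \<and> 0 < inner_radicand \<alpha>"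
  then have a: "cos \<alpha> < 0" "0 < sin \<alpha>" "3 * (cos \<alpha>)\<^sup>2 < 1" using cos_range by auto
  have "cos \<alpha> * sin \<alpha> < 0" using a by (simp add: mult_neg_pos)
  from biharmonic_helices_exist [OF _ a(3) this] *
  show "\<exists>(\<gamma> :: real \<Rightarrow> real \<Rightarrow> complex^3^3) E k.
           (\<forall>s\<in>{1, -1}.
              proper_biharmonic UNIV (\<gamma> s) \<and> class_I3 UNIV (\<gamma> s) (E s) (k s) \<and>
              (\<forall>t. k s 2 t = sin \<alpha> / sqrt 2 *
                       sqrt (1 - 3 * (cos \<alpha>)\<^sup>2 + s * sqrt (inner_radicand \<alpha>)) \<and>
                   k s 3 t = - (3 / (2 * k s 2 t)) * sin (2 * \<alpha>) \<and>
                   k s 1 t = - (1 / sin \<alpha>) * (k s 2 t * cos \<alpha> - k s 3 t * sin \<alpha>))) \<and>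
           (\<forall>t. k 1 2 t \<noteq> k (-1) 2 t)"
    unfolding abs_of_pos [OF a(2)] if_P [OF a(1)] by blast
next
  fix \<alpha> :: real
  assume *: "3 * pi / 2 < \<alpha> \<and> \<alpha> < pi + arccos (- ((2 - sqrt 3) / sqrt 2)) \<and> 0 < inner_radicand \<alpha>"
  have "cos (\<alpha> - pi) < 0" "0 < sin (\<alpha> - pi)" "3 * (cos (\<alpha> - pi))\<^sup>2 < 1"
    by (rule cos_range; use * in simp)+
  then have a: "\<not> cos \<alpha> < 0" "sin \<alpha> < 0" "3 * (cos \<alpha>)\<^sup>2 < 1" and "cos \<alpha> * sin \<alpha> < 0"
    by (simp_all add: cos_diff sin_diff mult_pos_neg)
  from biharmonic_helices_exist [OF _ a(3) this(4)] *
  show "\<exists>(\<gamma> :: real \<Rightarrow> real \<Rightarrow> complex^3^3) E k.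
           (\<forall>s\<in>{1, -1}.
              proper_biharmonic UNIV (\<gamma> s) \<and> class_I4 UNIV (\<gamma> s) (E s) (k s) \<and>
              (\<forall>t. k s 2 t = - (sin \<alpha> / sqrt 2) *
                       sqrt (1 - 3 * (cos \<alpha>)\<^sup>2 + s * sqrt (inner_radicand \<alpha>)) \<and>
                   k s 3 t = - (3 / (2 * k s 2 t)) * sin (2 * \<alpha>) \<and>
                   k s 1 t = - (1 / sin \<alpha>) * (k s 2 t * cos \<alpha> - k s 3 t * sin \<alpha>))) \<and>
           (\<forall>t. k 1 2 t \<noteq> k (-1) 2 t)"
    unfolding abs_of_neg [OF a(2)] if_not_P [OF a(1)] minus_divide_left [symmetric] by blast
qed

end
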